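(* Let $x(t)$ evolve by the ODE $\frac{\mathrm d}{\mathrm dt}x=f(x)$, $x(0)=x_0$, where $f\in C^1(\mathcal B,\mathbb R^n)$ and $\mathcal B\subset\mathbb R^n$ is forward invariant. For $k\in\{1,\dots,n\}$ let $\Phi_k(x,z^k)=(z^k)^{\mathsf T}Df^{[k]}(x)z^k$ and $\ell_k(x,z^k)=Df^{[k]}(x)z^k-\Phi_k(x,z^k)z^k$. 1. Suppose each trajectory $x(t)$ in $\mathcal B$ is bounded for $t\ge0$. For each $k\in\{1,\dots,n\}$, the maximum leading Lyapunov exponent sum $M_k$ among trajectories in $\mathcal B$ is bounded above by $$\sup_{x_0\in\mathcal B}M_k(x_0)\;\le\;\inf_{V\in C^1\left(\mathcal B\times\mathbb R^{\binom nk}\right)}\ \sup_{x\in\mathcal B,\ z^k\in\mathbb S^{\binom nk-1}}\left[\Phi_k+f\cdot D_xV+\ell_k\cdot D_{z^k}V\right],\qquad( * )$$ where $D_xV$ and $D_{z^k}V$ denote the gradients of $V(x,z^k)$ with respect to $x$ and $z^k$. 2. Suppose $\mathcal B$ is compact and $f\in C^2(\mathcal B,\mathbb R^n)$. Then $( * )$ holds with equality.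
   Context: $\mathcal B$ may be all of $\mathbb R^n$, a subdomain of $\mathbb R^n$, or a lower-dimensional manifold embedded in $\mathbb R^n$; forward invariant means trajectories starting in $\mathcal B$ remain in $\mathcal B$ for all $t\ge0$. $Df(x)$ is the $n\times n$ Jacobian. $\mathbb S^{m-1}=\{z\in\mathbb R^m:|z|=1\}$. For $A\in\mathbb R^{n\times n}$, the $k$th multiplicative compound $A^{(k)}\in\mathbb R^{\binom nk\times\binom nk}$ is the matrix of all $k\times k$ minors of $A$, rows and columns indexed by increasing $k$-tuples from $\{1,\dots,n\}$ in lexicographic order. The $k$th additive compound is $A^{[k]}=\frac{\mathrm d}{\mathrm d\delta}(I+\delta A)^{(k)}\big|_{\delta=0}$. $Df^{[k]}(x)$ denotes the $k$th additive compound of $Df(x)$. Along a trajectory $x(t)$ from $x_0$, let $y^k(t)\in\mathbb R^{\binom nk}$ solve $\frac{\mathrm d}{\mathrm dt}y^k=Df^{[k]}(x(t))\,y^k$, $y^k(0)=y^k_0$. The sum of the $k$ leading Lyapunov exponents is $$M_k(x_0)=\sup_{y_0^k\in\mathbb S^{\binom nk-1}}\ \limsup_{t\to\infty}\frac1t\log|y^k(t)|.$$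
   Formalization: For non-closed B, part 1 as stated fails (B=(0,1), f=-x, V=c ln x); it is proved instead with V of class C^1 near the closure of B times R^N, or with every trajectory contained in a compact subset of B. For closed B part 1 is as stated. *)

theory Defs
  imports
    "HOL-Analysis.Analysis"
    "HOL-Library.List_Lexorder"
    "Jordan_Normal_Form.Determinant"
begin

no_notation Matrix.vec_index (infixl \<open>$\<close> 100)
no_notation Matrix.scalar_prod (infix \<open>\<bullet>\<close> 70)

section \<open>Functions of class \<open>C\<^sup>r\<close>\<close>

text \<open>
  In finite dimension, \<open>g\<close> is \<open>C\<^sup>r\<^sup>+\<^sup>1\<close> on an open set iff it is differentiable there and each of
  its directional derivatives is \<open>C\<^sup>r\<close>.
\<close>

primrec Cr_open :: "nat \<Rightarrow> 'a::euclidean_space set \<Rightarrow> ('a \<Rightarrow> 'b::euclidean_space) \<Rightarrow> bool" where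
  "Cr_open 0 U g \<longleftrightarrow> continuous_on U g"
| "Cr_open (Suc r) U g \<longleftrightarrow>
     (\<forall>x\<in>U. g differentiable (at x)) \<and> (\<forall>v. Cr_open r U (\<lambda>x. frechet_derivative g (at x) v))"

text \<open>
  On a set \<open>S\<close> that need not be open (a closed domain, an embedded manifold), \<open>C\<^sup>r\<close> means \<open>C\<^sup>r\<close> on
  some open neighbourhood of \<open>S\<close>. In particular the full Jacobian is defined at every point
  of \<open>S\<close>, even if \<open>S\<close> has empty interior.
\<close>

definition Cr_on :: "nat \<Rightarrow> 'a::euclidean_space set \<Rightarrow> ('a \<Rightarrow> 'b::euclidean_space) \<Rightarrow> bool" where
  "Cr_on r S g \<longleftrightarrow> (\<exists>U. open U \<and> S \<subseteq> U \<and> Cr_open r U g)"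

definition gradient :: "('a::euclidean_space \<Rightarrow> real) \<Rightarrow> 'a \<Rightarrow> 'a" where
  "gradient g x = (THE D. GDERIV g x :> D)"

section \<open>Compound matrices\<close>

text \<open>
  For a finite linear order \<open>'m\<close> with as many elements as there are increasing \<open>k\<close>-tuples from
  \<open>'n\<close>, \<open>inc_tuple k\<close> is the enumeration of these tuples by \<open>'m\<close> in lexicographic order; the
  number \<open>card {..<i}\<close> is the position of \<open>i\<close> in \<open>'m\<close>.
\<close>

definition inc_tuple :: "nat \<Rightarrow> 'm::{finite,linorder} \<Rightarrow> 'n::{finite,linorder} list" where
  "inc_tuple k i = sorted_list_of_set {t. length t = k \<and> sorted_wrt (<) t} ! card {..<i}"

definition matrix_minor :: "real^'n^'n \<Rightarrow> 'n list \<Rightarrow> 'n list \<Rightarrow> real" where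
  "matrix_minor A I J =
     Determinant.det (Matrix.mat (length I) (length J) (\<lambda>(a, b). A $ (I ! a) $ (J ! b)))"

definition mult_compound ::
  "nat \<Rightarrow> real^'n::{finite,linorder}^'n::{finite,linorder} \<Rightarrow> real^'m::{finite,linorder}^'m::{finite,linorder}" where
  "mult_compound k A =
     (\<chi> i j. matrix_minor A (inc_tuple k i) (inc_tuple k j))"

definition add_compound ::
  "nat \<Rightarrow> real^'n::{finite,linorder}^'n::{finite,linorder} \<Rightarrow> real^'m::{finite,linorder}^'m::{finite,linorder}" where
  "add_compound k A =
     vector_derivative (\<lambda>\<delta>. mult_compound k (Finite_Cartesian_Product.mat 1 + \<delta> *\<^sub>R A)) (at 0)"

definition Df_compound ::
  "(real^'n::{finite,linorder} \<Rightarrow> real^'n::{finite,linorder}) \<Rightarrow> nat \<Rightarrow> real^'n::{finite,linorder}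
     \<Rightarrow> real^'m::{finite,linorder}^'m::{finite,linorder}" where
  "Df_compound f k x = add_compound k (jacobian f (at x))"

section \<open>Trajectories and Lyapunov exponent sums\<close>

definition ivp_solution ::
  "(real \<Rightarrow> 'a::real_normed_vector \<Rightarrow> 'a) \<Rightarrow> 'a \<Rightarrow> (real \<Rightarrow> 'a) \<Rightarrow> bool" where
  "ivp_solution F u0 u \<longleftrightarrow>
     u 0 = u0 \<and> (\<forall>t\<ge>0. (u has_vector_derivative F t (u t)) (at t within {0..}))"

abbreviation trajectory ::
  "('a::real_normed_vector \<Rightarrow> 'a) \<Rightarrow> 'a \<Rightarrow> (real \<Rightarrow> 'a) \<Rightarrow> bool" where
  "trajectory f \<equiv> ivp_solution (\<lambda>t. f)"

text \<open>
  Forward invariance includes existence of the trajectories for all \<open>t \<ge> 0\<close>, without which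
  \<open>x(t) \<in> B for all t \<ge> 0\<close> would be vacuous for solutions that blow up.
\<close>

definition forward_invariant :: "('a::real_normed_vector \<Rightarrow> 'a) \<Rightarrow> 'a set \<Rightarrow> bool" where
  "forward_invariant f B \<longleftrightarrow>
     (\<forall>x0\<in>B. (\<exists>x. trajectory f x0 x) \<and> (\<forall>x. trajectory f x0 x \<longrightarrow> (\<forall>t\<ge>0. x t \<in> B)))"

text \<open>
  The sum \<open>M\<^sub>k(x0)\<close> of the \<open>k\<close> leading Lyapunov exponents. For \<open>f\<close> of class \<open>C\<^sup>1\<close> on a forward
  invariant set containing \<open>x0\<close>, the solutions \<open>x\<close> and \<open>y\<close> below exist and are determined on
  \<open>t \<ge> 0\<close> by \<open>x0\<close> and \<open>y0\<close>, so the supremum effectively ranges over the unit sphere of initial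
  vectors \<open>y0\<close>. The type argument is the index type of \<open>y\<close>, which has \<open>n choose k\<close> elements.
\<close>

definition lyapunov_sum ::
  "'m::{finite,linorder} itself \<Rightarrow> (real^'n::{finite,linorder} \<Rightarrow> real^'n::{finite,linorder}) \<Rightarrow> nat
     \<Rightarrow> real^'n::{finite,linorder} \<Rightarrow> ereal" where
  "lyapunov_sum T f k x0 =
     Sup {Limsup at_top (\<lambda>t. ereal (1 / t * ln (norm (y t)))) | x y (y0 :: real^'m::{finite,linorder}).
            y0 \<in> sphere 0 1 \<and> trajectory f x0 x \<and>
            ivp_solution (\<lambda>t v. Df_compound f k (x t) *v v) y0 y}"

section \<open>The auxiliary-function bound\<close>

text \<open>
  A pitfall when \<open>B\<close> is not closed: a bounded trajectory may then approach the boundary of \<open>B\<close>,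
  where \<open>V\<close> can be unbounded if it is only \<open>C\<^sup>1\<close> near \<open>B \<times> UNIV\<close>, and the upper bound fails. For
  \<open>n = k = 1\<close>, \<open>B = {0<..<1}\<close>, \<open>f x = - x\<close> the exponent is \<open>- 1\<close>, while \<open>V (x, z) = c * ln x\<close>
  gives the value \<open>- 1 - c\<close>. For a non-closed \<open>B\<close> one needs either \<open>V\<close> to be \<open>C\<^sup>1\<close> up to the boundary,
  that is near \<open>closure B \<times> UNIV\<close>, or each trajectory to stay in a compact subset of \<open>B\<close>. For a
  closed \<open>B\<close> both conditions reduce to \<open>V\<close> being \<open>C\<^sup>1\<close> on \<open>B \<times> UNIV\<close> and trajectories being bounded.
\<close>

definition Phi ::
  "(real^'n::{finite,linorder} \<Rightarrow> real^'n::{finite,linorder}) \<Rightarrow> nat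
     \<Rightarrow> real^'n::{finite,linorder} \<Rightarrow> real^'m::{finite,linorder} \<Rightarrow> real" where
  "Phi f k x z = z \<bullet> (Df_compound f k x *v z)"

definition ell ::
  "(real^'n::{finite,linorder} \<Rightarrow> real^'n::{finite,linorder}) \<Rightarrow> nat
     \<Rightarrow> real^'n::{finite,linorder} \<Rightarrow> real^'m::{finite,linorder} \<Rightarrow> real^'m::{finite,linorder}" where
  "ell f k x z = Df_compound f k x *v z - Phi f k x z *\<^sub>R z"

definition aux_sup ::
  "(real^'n::{finite,linorder} \<Rightarrow> real^'n::{finite,linorder}) \<Rightarrow> nat \<Rightarrow> (real^'n::{finite,linorder}) set
     \<Rightarrow> ((real^'n::{finite,linorder}) \<times> (real^'m::{finite,linorder}) \<Rightarrow> real) \<Rightarrow> ereal" where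
  "aux_sup f k B V =
     (SUP (x, z) \<in> B \<times> sphere 0 1.
        ereal (Phi f k x z + f x \<bullet> gradient (\<lambda>x'. V (x', z)) x
               + ell f k x z \<bullet> gradient (\<lambda>z'. V (x, z')) z))"

end

theory Submission
  imports Defs
begin

text \<open>
  For a solution \<open>y\<close> of the compound equation, \<open>z = y / |y|\<close> obeys \<open>z' = ell\<close>, and \<open>ln |y|\<close> has derivative
  \<open>Phi\<close>. If \<open>s\<close> is the value of \<open>aux_sup\<close>, then \<open>ln |y| + V (x, z)\<close> grows at most with slope \<open>s\<close>, and
  \<open>V\<close> is bounded along the trajectory; this gives the upper bound.

  For the converse let \<open>F = (f, ell)\<close> on the compact set \<open>K = B \<times> sphere\<close> and let \<open>\<mu>\<close> exceed all exponent
  sums. A compactness argument gives \<open>ln |y T| \<le> \<mu> T + C\<close> uniformly in the starting point. The function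
  \<open>V p = \<integral>(1 - t / T) Phi (X t) dt\<close>, integrated over \<open>[0, T]\<close> along the orbit from \<open>p\<close>, would satisfy
  \<open>Phi + F \<bullet> \<nabla>V\<close> = average of \<open>Phi\<close> over \<open>[0, T]\<close>, which is at most \<open>\<mu> + C / T\<close>. To avoid differentiating the
  flow with respect to its initial point, the flow is replaced by iterates of the Euler map \<open>p + h F p\<close>,
  which are trivially \<open>C\<^sup>1\<close> on an open neighbourhood of \<open>B \<times> UNIV\<close>, at the price of an error that tends
  to 0 with \<open>h\<close>. About the compound matrices only the linearity of \<open>add_compound k\<close> is used.
\<close>

section \<open>Continuously differentiable maps\<close>

text \<open>The derivative is a \<open>blinfun\<close>-valued map, so its continuity is in operator
  norm. On compact sets this yields estimates uniform in the point and in the direction, which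
  \<open>Cr_open\<close> with its single directional derivatives does not offer directly.\<close>

definition C1_deriv ::
  "'a::real_normed_vector set \<Rightarrow> ('a \<Rightarrow> 'b::real_normed_vector) \<Rightarrow> ('a \<Rightarrow> 'a \<Rightarrow>\<^sub>L 'b) \<Rightarrow> bool" where
  "C1_deriv \<Omega> G G' \<longleftrightarrow>
     (\<forall>p\<in>\<Omega>. (G has_derivative blinfun_apply (G' p)) (at p)) \<and> continuous_on \<Omega> G'"

lemma C1_deriv_continuous_on: "C1_deriv \<Omega> G G' \<Longrightarrow> continuous_on \<Omega> G"
  unfolding C1_deriv_def
  by (meson continuous_at_imp_continuous_on has_derivative_continuous)

lemma C1_deriv_subset: "C1_deriv \<Omega> G G' \<Longrightarrow> \<Omega>' \<subseteq> \<Omega> \<Longrightarrow> C1_deriv \<Omega>' G G'"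
  unfolding C1_deriv_def by (meson continuous_on_subset subsetD)

text \<open>A compact subset of an open set has a closed neighbourhood inside that set which is
  again compact. There \<open>G'\<close> is uniformly continuous, and the mean value inequality on a
  ball around \<open>p\<close> turns the small oscillation of \<open>G'\<close> into the error.
  Hence \<open>r\<close> does not depend on \<open>p\<close>.\<close>

lemma C1_deriv_uniform_linearization:
  fixes G :: "'a::euclidean_space \<Rightarrow> 'b::real_normed_vector"
  assumes "C1_deriv \<Omega> G G'" "open \<Omega>" "compact K" "K \<subseteq> \<Omega>" "\<eta> > 0"
  obtains r where "r > 0"
    "\<And>p v. p \<in> K \<Longrightarrow> norm v \<le> r \<Longrightarrow> p + v \<in> \<Omega> \<and> norm (G (p + v) - G p - G' p v) \<le> \<eta> * norm v"
proof -
  obtain e where e: "e > 0" "(\<Union>x\<in>K. cball x e) \<subseteq> \<Omega>"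
    using compact_subset_open_imp_cball_epsilon_subset assms by metis
  let ?K = "\<Union>x\<in>K. cball x e"
  have sub: "?K = {x + y |x y. x \<in> K \<and> y \<in> cball 0 e}"
    by (force simp: dist_norm norm_minus_commute intro: exI[of _ "_ - _"])
  have cK: "compact ?K"
    unfolding sub by (intro compact_sums assms compact_cball)
  have der: "(G has_derivative blinfun_apply (G' p)) (at p)" if "p \<in> \<Omega>" for p
    using assms(1) that by (auto simp: C1_deriv_def)
  have "uniformly_continuous_on ?K G'"
    using cK e assms(1) by (intro compact_uniformly_continuous) (auto simp: C1_deriv_def intro: continuous_on_subset)
  then obtain d where d: "d > 0"
    "\<And>x y. x \<in> ?K \<Longrightarrow> y \<in> ?K \<Longrightarrow> dist y x < d \<Longrightarrow> dist (G' y) (G' x) < \<eta>"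
    unfolding uniformly_continuous_on_def using assms(5) by metis
  \<comment> \<open>The bound \<open>e\<close> keeps the ball around \<open>p\<close> in the compact
    neighbourhood; halving \<open>d\<close> yields the strict inequality that uniform continuity
    asks for.\<close>
  define r where "r = min e (d/2)"
  have r: "r > 0" "r \<le> e" "r < d" using e d by (auto simp: r_def)
  show thesis
  proof (rule that[OF r(1)])
    fix p v assume p: "p \<in> K" and v: "norm (v::'a) \<le> r"
    have pv: "p + t *\<^sub>R v \<in> cball p r" if "t \<in> {0..1}" for t
    proof -
      have "norm (t *\<^sub>R v) \<le> 1 * norm v" using that by (simp add: mult_left_le_one_le)
      then show ?thesis using v by (simp add: dist_norm)
    qed
    have inK: "x \<in> ?K" if "x \<in> cball p r" for x
      using that p r by force
    have "norm (G (p + v) - G p - blinfun_apply (G' p) (p + v - p)) \<le> norm (p + v - p) * \<eta>"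
    proof (rule differentiable_bound_linearization[where S="cball p r" and f'="\<lambda>x. blinfun_apply (G' x)"])
      fix x assume x: "x \<in> cball p r"
      show "(G has_derivative blinfun_apply (G' x)) (at x within cball p r)"
        using inK[OF x] e der has_derivative_at_withinI by blast
      have "dist (G' x) (G' p) < \<eta>"
        using x r by (intro d inK) (auto simp: dist_commute)
      then show "onorm (blinfun_apply (G' x) - blinfun_apply (G' p)) \<le> \<eta>"
        by (simp add: dist_norm norm_blinfun.rep_eq minus_blinfun.rep_eq fun_diff_def)
    qed (use pv r in \<open>auto\<close>)
    moreover have "p + v \<in> \<Omega>"
      using pv[of 1] inK[of "p + v"] e by (auto simp del: mem_cball)
    ultimately show "p + v \<in> \<Omega> \<and> norm (G (p + v) - G p - G' p v) \<le> \<eta> * norm v"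
      by (simp add: mult.commute)
  qed
qed

lemma C1_deriv_bounds:
  assumes "C1_deriv \<Omega> G G'" "compact K" "K \<subseteq> \<Omega>"
  obtains M where "M > 0" "\<And>p. p \<in> K \<Longrightarrow> norm (G p) \<le> M" "\<And>p. p \<in> K \<Longrightarrow> norm (G' p) \<le> M"
proof -
  have "continuous_on K G" "continuous_on K G'"
    using assms C1_deriv_continuous_on[OF assms(1)] continuous_on_subset unfolding C1_deriv_def by blast+
  then have "compact (G ` K)" "compact (G' ` K)"
    using assms(2) by (simp_all add: compact_continuous_image)
  then have "bounded (G ` K)" "bounded (G' ` K)" using compact_imp_bounded by auto
  then obtain a b where "\<forall>x\<in>G ` K. norm x \<le> a" "\<forall>x\<in>G' ` K. norm x \<le> b"
    unfolding bounded_iff by auto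
  then show thesis
    by (intro that[of "max 1 (max a b)"]) (auto simp: le_max_iff_disj)
qed

text \<open>\<open>K\<close> may fail to be convex, so the estimate is local: one point in
  \<open>K\<close>, the other within distance \<open>r\<close>. It follows from the linearization
  with error factor 1 and a bound on \<open>G'\<close> over \<open>K\<close>.\<close>

lemma C1_deriv_uniform_lipschitz:
  fixes G :: "'a::euclidean_space \<Rightarrow> 'b::real_normed_vector"
  assumes "C1_deriv \<Omega> G G'" "open \<Omega>" "compact K" "K \<subseteq> \<Omega>"
  obtains r L where "r > 0" "L > 0"
    "\<And>p q. p \<in> K \<Longrightarrow> dist q p \<le> r \<Longrightarrow> q \<in> \<Omega> \<and> norm (G q - G p) \<le> L * dist q p"
proof -
  have one: "(1::real) > 0" by simp
  obtain r where r: "r > 0"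
    "\<And>p v. p \<in> K \<Longrightarrow> norm v \<le> r \<Longrightarrow> p + v \<in> \<Omega> \<and> norm (G (p + v) - G p - G' p v) \<le> 1 * norm v"
    by (rule C1_deriv_uniform_linearization[OF assms one]) (rule that)
  obtain M where M: "M > 0" "\<And>p. p \<in> K \<Longrightarrow> norm (G' p) \<le> M"
    using C1_deriv_bounds[OF assms(1,3,4)] by metis
  show thesis
  proof (rule that[of r "M + 1"])
    fix p q assume p: "p \<in> K" and q: "dist q p \<le> r"
    have "norm (G' p (q - p)) \<le> M * norm (q - p)"
      using norm_blinfun[of "G' p" "q - p"] M(2)[OF p]
      by (meson mult_right_mono norm_ge_zero order_trans)
    moreover have "q \<in> \<Omega> \<and> norm (G q - G p - G' p (q - p)) \<le> norm (q - p)"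
      using r(2)[OF p, of "q - p"] q by (simp add: dist_norm)
    ultimately show "q \<in> \<Omega> \<and> norm (G q - G p) \<le> (M + 1) * dist q p"
      using norm_triangle_ineq[of "G q - G p - G' p (q - p)" "G' p (q - p)"]
      by (auto simp: dist_norm algebra_simps)
  qed (use r M in auto)
qed

section \<open>Euler iterates and orbits\<close>

definition euler :: "real \<Rightarrow> ('a::real_normed_vector \<Rightarrow> 'a) \<Rightarrow> nat \<Rightarrow> 'a \<Rightarrow> 'a" where
  "euler h F j = ((\<lambda>p. p + h *\<^sub>R F p) ^^ j)"

lemma euler_0 [simp]: "euler h F 0 p = p"
  and euler_Suc [simp]: "euler h F (Suc j) p = euler h F j p + h *\<^sub>R F (euler h F j p)"
  by (simp_all add: euler_def)

text \<open>The variational equation in discrete time. By the chain rule its solution is the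
  derivative of \<open>euler h F j\<close> in the initial point.\<close>

primrec euler_deriv ::
  "real \<Rightarrow> ('a::real_normed_vector \<Rightarrow> 'a) \<Rightarrow> ('a \<Rightarrow> 'a \<Rightarrow>\<^sub>L 'a) \<Rightarrow> nat \<Rightarrow> 'a \<Rightarrow> 'a \<Rightarrow>\<^sub>L 'a" where
  "euler_deriv h F F' 0 p = id_blinfun"
| "euler_deriv h F F' (Suc j) p = 
     euler_deriv h F F' j p + h *\<^sub>R (F' (euler h F j p) o\<^sub>L euler_deriv h F F' j p)"

text \<open>The strict \<open>j<N\<close> matters: the iterate of index \<open>N\<close> evaluates
  \<open>F\<close> only at earlier iterates and may itself lie outside
  \<open>\<Omega>\<close>.\<close>

definition euler_dom :: "real \<Rightarrow> ('a::real_normed_vector \<Rightarrow> 'a) \<Rightarrow> 'a set \<Rightarrow> nat \<Rightarrow> 'a set" where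
  "euler_dom h F \<Omega> N = {p. \<forall>j<N. euler h F j p \<in> \<Omega>}"

lemma euler_C1_deriv:
  assumes "C1_deriv \<Omega> F F'" "open \<Omega>"
  shows "open (euler_dom h F \<Omega> N) \<and> C1_deriv (euler_dom h F \<Omega> N) (euler h F N) (euler_deriv h F F' N)"
proof (induction N)
  case 0
  show ?case by (auto simp: euler_dom_def C1_deriv_def id_blinfun.rep_eq euler_def)
next
  case (Suc N)
  let ?D = "euler_dom h F \<Omega> N" and ?E = "euler_dom h F \<Omega> (Suc N)"
  have eq: "?E = ?D \<inter> euler h F N -` \<Omega>"
    by (auto simp: euler_dom_def less_Suc_eq)
  have C: "C1_deriv ?E (euler h F N) (euler_deriv h F F' N)"
    using Suc eq by (auto intro: C1_deriv_subset)
  have "open ?E"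
    unfolding eq using Suc assms C1_deriv_continuous_on by (blast intro: continuous_open_preimage)
  moreover have "(euler h F (Suc N) has_derivative blinfun_apply (euler_deriv h F F' (Suc N) p)) (at p)"
    if p: "p \<in> ?E" for p
  proof -
    have *: "(euler h F N has_derivative blinfun_apply (euler_deriv h F F' N p)) (at p)"
      using C p by (auto simp: C1_deriv_def)
    have "(F has_derivative blinfun_apply (F' (euler h F N p))) (at (euler h F N p))"
      using p eq assms(1) by (auto simp: C1_deriv_def)
    from has_derivative_compose[OF * this]
    have "((\<lambda>p. euler h F N p + h *\<^sub>R F (euler h F N p)) has_derivative
       (\<lambda>v. euler_deriv h F F' N p v + h *\<^sub>R F' (euler h F N p) (euler_deriv h F F' N p v))) (at p)"
      by (intro has_derivative_add * has_derivative_scaleR_right)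
    then show ?thesis
      by (simp add: blinfun.add_left blinfun.scaleR_left plus_blinfun.rep_eq scaleR_blinfun.rep_eq euler_def o_def)
  qed
  moreover have "continuous_on ?E (euler_deriv h F F' (Suc N))"
  proof -
    have "continuous_on ?E (\<lambda>p. F' (euler h F N p))"
      using assms(1) C1_deriv_continuous_on[OF C] eq
      by (auto simp: C1_deriv_def intro!: continuous_on_compose2[of \<Omega> F'])
    moreover have "continuous_on ?E (euler_deriv h F F' N)"
      using C by (auto simp: C1_deriv_def)
    ultimately show ?thesis
      by (auto intro!: continuous_intros bounded_bilinear.continuous_on[OF bounded_bilinear_blinfun_compose])
  qed
  ultimately show ?case unfolding C1_deriv_def by blast
qed

text \<open>Induction with the sharper bound \<open>j * b * exp (c * j)\<close>. The recursion is
  assumed only while \<open>a j\<close> is below the final bound, because the Lipschitz estimates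
  that supply it hold only near \<open>K\<close>; the bound already proved is what keeps the
  iterates there.\<close>

lemma discrete_gronwall:
  fixes a :: "nat \<Rightarrow> real" and N j :: nat and b c :: real
  assumes "a 0 \<le> 0" "c \<ge> 0" "b \<ge> 0"
    and step: "\<And>j. j < N \<Longrightarrow> a j \<le> N * b * exp (c * N) \<Longrightarrow> a (Suc j) \<le> (1 + c) * a j + b"
    and "j \<le> N"
  shows "a j \<le> N * b * exp (c * N)"
proof -
  have mono: "i * b * exp (c * i) \<le> N * b * exp (c * N)" if "i \<le> N" for i
    using that assms by (intro mult_mono) (auto intro: mult_left_mono)
  have "a j \<le> j * b * exp (c * j)" using assms(5)
  proof (induction j)
    case 0 then show ?case using assms by simp
  next
    case (Suc j)
    then have IH: "a j \<le> j * b * exp (c * j)" by simp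
    have "a (Suc j) \<le> (1 + c) * a j + b"
      using step[of j] IH mono[of j] Suc.prems by simp
    also have "\<dots> \<le> (1 + c) * (j * b * exp (c * j)) + b"
      using IH assms(2) by (intro add_mono mult_left_mono) auto
    also have "\<dots> \<le> exp c * (j * b * exp (c * j)) + b * exp (c * Suc j)"
      using assms mult_left_mono[of 1 "exp (c * Suc j)" b]
      by (intro add_mono mult_right_mono exp_ge_add_one_self) auto
    also have "\<dots> = Suc j * b * exp (c * Suc j)"
      by (simp add: algebra_simps exp_add)
    finally show ?case .
  qed
  then show ?thesis using mono[OF assms(5)] by linarith
qed

text \<open>In the application \<open>I t\<close> is \<open>ln (norm (y t))\<close>.\<close>

definition orbit_in ::
  "'a::real_normed_vector set \<Rightarrow> ('a \<Rightarrow> 'a) \<Rightarrow> ('a \<Rightarrow> real) \<Rightarrow> (real \<Rightarrow> 'a) \<Rightarrow> (real \<Rightarrow> real) \<Rightarrow> bool" where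
  "orbit_in K F \<Phi> X I \<longleftrightarrow> I 0 = 0 \<and> (\<forall>t\<ge>0. X t \<in> K \<and>
     (X has_vector_derivative F (X t)) (at t within {0..}) \<and>
     (I has_vector_derivative \<Phi> (X t)) (at t within {0..}))"

section \<open>Time shifts of orbits and the error of a single time step\<close>

lemma vector_derivative_shift:
  fixes X :: "real \<Rightarrow> 'a::real_normed_vector"
  assumes "(X has_vector_derivative D) (at (t + s) within {0..})" "s \<ge> 0"
  shows "((\<lambda>t. X (t + s)) has_vector_derivative D) (at t within {0..})"
proof -
  have "(X has_vector_derivative D) (at (t + s) within (\<lambda>t. t + s) ` {0..})"
    by (rule has_vector_derivative_within_subset[OF assms(1)]) (use assms(2) in auto)
  moreover have "((\<lambda>t. t + s) has_vector_derivative 1) (at t within {0..})"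
    by (auto intro!: derivative_eq_intros)
  ultimately show ?thesis
    using vector_diff_chain_within[of "\<lambda>t. t + s" 1 t "{0..}" X D] by (simp add: o_def)
qed

lemma orbit_in_shift:
  assumes "orbit_in K F \<Phi> X I" "s \<ge> 0"
  shows "orbit_in K F \<Phi> (\<lambda>t. X (t + s)) (\<lambda>t. I (t + s) - I s)"
  using assms
  by (auto simp: orbit_in_def has_vector_derivative_diff_const intro!: vector_derivative_shift)

text \<open>The mean value inequality for \<open>f x - x *\<^sub>R c\<close>. With
  \<open>c = 0\<close> it bounds increments, with \<open>c = G (X t)\<close> the error of a
  first-order step.\<close>

lemma vector_derivative_bound:
  fixes f :: "real \<Rightarrow> 'b::real_normed_vector"
  assumes "a \<le> b" "\<And>x. x \<in> {a..b} \<Longrightarrow> (f has_vector_derivative f' x) (at x within {a..b})"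
    and B: "\<And>x. x \<in> {a..b} \<Longrightarrow> norm (f' x - c) \<le> B"
  shows "norm (f b - f a - (b - a) *\<^sub>R c) \<le> B * (b - a)"
proof -
  define g where "g x = f x - x *\<^sub>R c" for x
  have g: "(g has_derivative (\<lambda>h. h *\<^sub>R (f' x - c))) (at x within {a..b})" if "x \<in> {a..b}" for x
  proof -
    have "(g has_vector_derivative (f' x - c)) (at x within {a..b})"
      unfolding g_def using assms(2)[OF that] by (auto intro!: derivative_eq_intros)
    then show ?thesis by (simp add: has_vector_derivative_def)
  qed
  have "norm (g b - g a) \<le> B * norm (b - a)"
  proof (rule differentiable_bound[OF _ g])
    show "onorm (\<lambda>h. h *\<^sub>R (f' x - c)) \<le> B" if "x \<in> {a..b}" for x
      using B[OF that] by (simp add: onorm_scaleR_left_lemma onorm_scaleR_left onorm_id)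
  qed (use assms in auto)
  then show ?thesis using assms(1) by (simp add: g_def algebra_simps)
qed

text \<open>Within time \<open>h\<close> the orbit moves by at most \<open>M * h\<close>, so
  \<open>G\<close> along it changes by at most \<open>L * M * h\<close>; integration gives the
  second order. The choice \<open>Y = X\<close> yields the truncation error of the Euler scheme,
  \<open>Y = I\<close> that of the left Riemann sum for \<open>I\<close>.\<close>

lemma orbit_step:
  fixes G :: "'a::euclidean_space \<Rightarrow> 'b::real_normed_vector"
  assumes X: "\<And>t. t \<ge> 0 \<Longrightarrow> X t \<in> K" "\<And>t. t \<ge> 0 \<Longrightarrow> (X has_vector_derivative F (X t)) (at t within {0..})"
    and Y: "\<And>t. t \<ge> 0 \<Longrightarrow> (Y has_vector_derivative G (X t)) (at t within {0..})"
    and M: "\<And>p. p \<in> K \<Longrightarrow> norm (F p) \<le> M"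
    and L: "\<And>p q. p \<in> K \<Longrightarrow> dist q p \<le> r \<Longrightarrow> norm (G q - G p) \<le> L * dist q p"
    and h: "h \<ge> 0" "M * h \<le> r" and t: "t \<ge> 0" and L0: "L \<ge> 0"
  shows "norm (Y (t + h) - Y t - h *\<^sub>R G (X t)) \<le> L * M * h\<^sup>2"
proof -
  have M0: "M \<ge> 0" using M[OF X(1)[of 0]] norm_ge_zero order_trans by blast
  have near: "dist (X s) (X t) \<le> M * h" if s: "s \<in> {t..t+h}" for s
  proof -
    have "norm (X s - X t - (s - t) *\<^sub>R 0) \<le> M * (s - t)"
      by (rule vector_derivative_bound[where f'="\<lambda>u. F (X u)"])
        (use s t X M in \<open>auto intro!: has_vector_derivative_within_subset[OF X(2)]\<close>)
    also have "\<dots> \<le> M * h" using s M0 by (intro mult_left_mono) auto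
    finally show ?thesis by (simp add: dist_norm)
  qed
  have "norm (Y (t + h) - Y t - (t + h - t) *\<^sub>R G (X t)) \<le> L * M * h * (t + h - t)"
  proof (rule vector_derivative_bound[where f'="\<lambda>u. G (X u)"])
    fix s assume s: "s \<in> {t..t+h}"
    show "(Y has_vector_derivative G (X s)) (at s within {t..t + h})"
      by (rule has_vector_derivative_within_subset[OF Y]) (use s t in auto)
    have "norm (G (X s) - G (X t)) \<le> L * dist (X s) (X t)"
      using near[OF s] h X t by (intro L) auto
    also have "\<dots> \<le> L * (M * h)" using near[OF s] L0 by (intro mult_left_mono)
    finally show "norm (G (X s) - G (X t)) \<le> L * M * h" by simp
  qed (use h in auto)
  then show ?thesis by (simp add: power2_eq_square algebra_simps)
qed

text \<open>Errors of order \<open>h\<^sup>2\<close> per step add up to order \<open>h\<close> over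
  \<open>[0, T]\<close> by the discrete Gronwall inequality. All constants come from
  \<open>K\<close>, so one \<open>N0\<close> serves every orbit in \<open>K\<close>; this uniformity
  replaces continuous dependence on the initial point.\<close>

lemma euler_orbit_approx:
  fixes F :: "'a::euclidean_space \<Rightarrow> 'a" and \<Phi> :: "'a \<Rightarrow> real"
  assumes F: "C1_deriv \<Omega> F F'" and \<Phi>: "C1_deriv \<Omega> \<Phi> \<Phi>'"
    and \<Omega>: "open \<Omega>" and K: "compact K" "K \<subseteq> \<Omega>" and T: "T > 0" and \<epsilon>: "\<epsilon> > 0"
  obtains N0 :: nat where "N0 > 0"
    "\<And>N X I j. N \<ge> N0 \<Longrightarrow> orbit_in K F \<Phi> X I \<Longrightarrow> j \<le> N \<Longrightarrow>
      euler (T / N) F j (X 0) \<in> \<Omega> \<and> dist (euler (T / N) F j (X 0)) (X (j * (T / N))) \<le> \<epsilon>"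
    "\<And>N X I. N \<ge> N0 \<Longrightarrow> orbit_in K F \<Phi> X I \<Longrightarrow>
      \<bar>I T - T / N * (\<Sum>j<N. \<Phi> (euler (T / N) F j (X 0)))\<bar> \<le> \<epsilon>"
proof -
  obtain r1 L1 where r1: "r1 > 0" "L1 > 0"
    "\<And>p q. p \<in> K \<Longrightarrow> dist q p \<le> r1 \<Longrightarrow> q \<in> \<Omega> \<and> norm (F q - F p) \<le> L1 * dist q p"
    using C1_deriv_uniform_lipschitz[OF F \<Omega> K] by metis
  obtain r2 L2 where r2: "r2 > 0" "L2 > 0"
    "\<And>p q. p \<in> K \<Longrightarrow> dist q p \<le> r2 \<Longrightarrow> q \<in> \<Omega> \<and> norm (\<Phi> q - \<Phi> p) \<le> L2 * dist q p"
    using C1_deriv_uniform_lipschitz[OF \<Phi> \<Omega> K] by metis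
  obtain M where M: "M > 0" "\<And>p. p \<in> K \<Longrightarrow> norm (F p) \<le> M"
    using C1_deriv_bounds[OF F K] by metis
  define r L where "r = min r1 r2" and "L = max L1 L2"
  have r: "r > 0" and L: "L > 0" using r1 r2 by (auto simp: r_def L_def)
  have LF: "q \<in> \<Omega>" "norm (F q - F p) \<le> L * dist q p" "norm (\<Phi> q - \<Phi> p) \<le> L * dist q p"
    if "p \<in> K" "dist q p \<le> r" for p q
  proof -
    have "L1 * dist q p \<le> L * dist q p" "L2 * dist q p \<le> L * dist q p"
      by (auto simp: L_def intro!: mult_right_mono)
    then show "q \<in> \<Omega>" "norm (F q - F p) \<le> L * dist q p" "norm (\<Phi> q - \<Phi> p) \<le> L * dist q p"
      using r1(3)[of p q] r2(3)[of p q] that by (auto simp: r_def)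
  qed
  \<comment> \<open>\<open>\<kappa> * h\<close> is the Gronwall bound for the distance between Euler
    iterate and orbit. \<open>C\<close> sums the constants of all smallness conditions on
    \<open>h\<close>, so that \<open>C * h \<le> \<delta>\<close> implies each of them.\<close>
  define \<kappa> where "\<kappa> = T * L * M * exp (L * T)"
  define C where "C = \<kappa> + M + T * L * (M + \<kappa>)"
  define \<delta> where "\<delta> = min r \<epsilon>"
  have \<kappa>: "\<kappa> > 0" using T L M by (simp add: \<kappa>_def)
  have C: "C > 0" using T L M \<kappa> by (auto simp: C_def intro!: add_pos_pos)
  have \<delta>: "\<delta> > 0" using r \<epsilon> by (simp add: \<delta>_def)
  obtain N0 where N0: "T * C / \<delta> < real N0" using reals_Archimedean2 by blast
  have N0': "N0 > 0"
    using order.strict_trans1[OF _ N0, of 0] T C \<delta> by simp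
  have main: "\<bar>I T - T / N * (\<Sum>j<N. \<Phi> (euler (T / N) F j (X 0)))\<bar> \<le> \<epsilon> \<and>
      (j \<le> N \<longrightarrow> euler (T / N) F j (X 0) \<in> \<Omega> \<and> dist (euler (T / N) F j (X 0)) (X (j * (T / N))) \<le> \<epsilon>)"
    if N: "N \<ge> N0" and orb: "orbit_in K F \<Phi> X I" for N X I j
  proof -
    define h where "h = T / N"
    have Npos: "N > 0" using N N0' by simp
    have h: "h > 0" and Nh: "N * h = T" using T Npos by (auto simp: h_def)
    have "T * C / \<delta> < real N" using N N0 by linarith
    then have hC: "C * h \<le> \<delta>"
      using \<delta> Npos by (simp add: h_def field_simps)
    have "\<kappa> * h \<le> C * h" "M * h \<le> C * h" "T * L * (M + \<kappa>) * h \<le> C * h"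
      using \<kappa> M T L h by (auto simp: C_def intro!: mult_right_mono)
    with hC have hs: "\<kappa> * h \<le> r" "\<kappa> * h \<le> \<epsilon>" "M * h \<le> r" "T * L * (M + \<kappa>) * h \<le> \<epsilon>"
      by (auto simp: \<delta>_def)
    define q where "q i = euler h F i (X 0)" for i
    have Xd: "X t \<in> K" "(X has_vector_derivative F (X t)) (at t within {0..})"
      "(I has_vector_derivative \<Phi> (X t)) (at t within {0..})" if "t \<ge> 0" for t
      using orb that by (auto simp: orbit_in_def)
    have stepF: "norm (X (t + h) - X t - h *\<^sub>R F (X t)) \<le> L * M * h\<^sup>2" if "t \<ge> 0" for t
      by (rule orbit_step[of X K F _ F M r]) (use Xd M LF hs h that L in auto)
    have step\<Phi>: "norm (I (t + h) - I t - h *\<^sub>R \<Phi> (X t)) \<le> L * M * h\<^sup>2" if "t \<ge> 0" for t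
      by (rule orbit_step[of X K F _ \<Phi> M r]) (use Xd M LF hs h that L in auto)
    have \<kappa>h: "\<kappa> * h = N * (L * M * h\<^sup>2) * exp (h * L * N)"
      by (simp add: \<kappa>_def Nh[symmetric] power2_eq_square algebra_simps)
    have e: "dist (q i) (X (i * h)) \<le> \<kappa> * h" if "i \<le> N" for i
      unfolding \<kappa>h
    proof (rule discrete_gronwall[OF _ _ _ _ that, where a = "\<lambda>i. dist (q i) (X (i * h))"], goal_cases)
      case (4 i)
      let ?x = "X (i * h)" and ?y = "X (i * h + h)"
      \<comment> \<open>The conditional form of the Gronwall step places \<open>q i\<close> where
        the Lipschitz estimate holds. The new error is then the old one, its amplification by
        \<open>F\<close>, and the truncation error of the orbit.\<close>
      have near: "dist (q i) ?x \<le> r" using 4(2) hs(1) \<kappa>h by simp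
      have "q (Suc i) - ?y = (q i - ?x) + h *\<^sub>R (F (q i) - F ?x) - (?y - ?x - h *\<^sub>R F ?x)"
        by (simp add: q_def algebra_simps)
      also have "norm \<dots> \<le> norm (q i - ?x) + norm (h *\<^sub>R (F (q i) - F ?x)) + norm (?y - ?x - h *\<^sub>R F ?x)"
        by (meson add_right_mono norm_triangle_ineq norm_triangle_ineq4 order_trans)
      also have "\<dots> \<le> dist (q i) ?x + h * (L * dist (q i) ?x) + L * M * h\<^sup>2"
        using h near LF(2)[OF _ near] Xd(1) stepF
        by (auto simp: dist_norm intro!: add_mono mult_left_mono)
      finally show ?case by (simp add: dist_norm algebra_simps)
    qed (use L M h in \<open>auto simp: q_def\<close>)
    \<comment> \<open>In the bracket \<open>\<kappa>\<close> accounts for evaluating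
      \<open>\<Phi>\<close> at the Euler iterate instead of the orbit, and \<open>M\<close> for the
      Riemann sum along the orbit.\<close>
    have err: "\<bar>I (Suc i * h) - I (i * h) - h * \<Phi> (q i)\<bar> \<le> h * (L * (M + \<kappa>) * h)" if "i < N" for i
    proof -
      have ei: "dist (q i) (X (i * h)) \<le> \<kappa> * h" using e[of i] that by simp
      have "\<bar>\<Phi> (q i) - \<Phi> (X (i * h))\<bar> \<le> L * dist (q i) (X (i * h))"
        using LF(3)[of "X (i * h)" "q i"] ei hs Xd(1) h by auto
      also have "\<dots> \<le> L * (\<kappa> * h)" using ei L by (intro mult_left_mono) auto
      finally have "h * \<bar>\<Phi> (q i) - \<Phi> (X (i * h))\<bar> \<le> h * (L * (\<kappa> * h))" using h by (intro mult_left_mono) auto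
      moreover have "h * \<bar>\<Phi> (q i) - \<Phi> (X (i * h))\<bar> = \<bar>h * \<Phi> (q i) - h * \<Phi> (X (i * h))\<bar>"
        using h by (simp add: abs_mult flip: right_diff_distrib)
      moreover have "\<bar>I (Suc i * h) - I (i * h) - h * \<Phi> (X (i * h))\<bar> \<le> L * M * h\<^sup>2"
        using step\<Phi>[of "i * h"] h by (simp add: algebra_simps)
      ultimately show ?thesis by (simp add: algebra_simps power2_eq_square)
    qed
    \<comment> \<open>The increments of \<open>I\<close> telescope to \<open>I T\<close>, as
      \<open>I 0 = 0\<close>.\<close>
    have "I T - h * (\<Sum>i<N. \<Phi> (q i)) = (\<Sum>i<N. I (Suc i * h) - I (i * h) - h * \<Phi> (q i))"
      using orb sum_lessThan_telescope[of "\<lambda>i. I (i * h)" N]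
      by (simp add: sum_subtractf sum_distrib_left Nh orbit_in_def)
    also have "\<bar>\<dots>\<bar> \<le> N * (h * (L * (M + \<kappa>) * h))"
      by (rule order_trans[OF sum_abs order_trans[OF sum_bounded_above[OF err]]]) auto
    also have "\<dots> = (N * h) * L * (M + \<kappa>) * h" by simp
    also have "\<dots> \<le> \<epsilon>" using hs(4) unfolding Nh by simp
    finally have "\<bar>I T - h * (\<Sum>i<N. \<Phi> (q i))\<bar> \<le> \<epsilon>" .
    moreover have "q j \<in> \<Omega> \<and> dist (q j) (X (j * h)) \<le> \<epsilon>" if "j \<le> N"
      using e[OF that] hs h LF(1)[of "X (j * h)" "q j"] Xd(1)[of "j * h"] by auto
    ultimately show ?thesis by (auto simp: q_def h_def)
  qed
  show thesis
    using main N0' by (intro that[of N0]) blast+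
qed

section \<open>Derivative of the weighted Riemann sum along \<open>F\<close>\<close>

text \<open>Discrete integration by parts against a linear weight, taken at the right end
  \<open>j + 1\<close> of each step. For \<open>c = n\<close> the boundary term at \<open>n\<close>
  vanishes, and division by \<open>n\<close> leaves the average of \<open>a\<close> minus
  \<open>a 0\<close>.\<close>

lemma sum_by_parts_linear_weight:
  fixes a :: "nat \<Rightarrow> real"
  shows "(\<Sum>j<n. (c - 1 - j) * (a (Suc j) - a j)) = (\<Sum>j<n. a j) - c * a 0 + (c - n) * a n"
  by (induction n) (auto simp: algebra_simps)

text \<open>
  The error is the one made by replacing \<open>euler_deriv h F F' j p (F p)\<close> by \<open>F (euler h F j p)\<close>: along an
  exact flow the two agree. Then \<open>h\<close> times the derivative of \<open>\<Phi>\<close> is close to an increment of \<open>\<Phi>\<close>, and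
  the weights turn the sum of the increments into an average.
\<close>

lemma euler_variation:
  fixes F :: "'a::euclidean_space \<Rightarrow> 'a" and \<Phi> :: "'a \<Rightarrow> real"
  assumes F: "C1_deriv \<Omega> F F'" and \<Phi>: "C1_deriv \<Omega> \<Phi> \<Phi>'"
    and \<Omega>: "open \<Omega>" and K: "compact K" "K \<subseteq> \<Omega>" and T: "T > 0" and \<epsilon>: "\<epsilon> > 0"
  obtains N0 :: nat where "N0 > 0"
    "\<And>N p. N \<ge> N0 \<Longrightarrow> \<forall>j\<le>N. euler (T / real N) F j p \<in> K \<Longrightarrow>
      \<bar>\<Phi> p + T / real N * (\<Sum>j<N. (real N - 1 - real j) / real N *
           \<Phi>' (euler (T / real N) F j p) (euler_deriv (T / real N) F F' j p (F p)))
         - (\<Sum>j<N. \<Phi> (euler (T / real N) F j p)) / real N\<bar> \<le> \<epsilon>"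
proof -
  obtain M1 where M1: "M1 > 0" "\<And>p. p \<in> K \<Longrightarrow> norm (F p) \<le> M1" "\<And>p. p \<in> K \<Longrightarrow> norm (F' p) \<le> M1"
    using C1_deriv_bounds[OF F K] by metis
  obtain M2 where M2: "M2 > 0" "\<And>p. p \<in> K \<Longrightarrow> norm (\<Phi>' p) \<le> M2"
    using C1_deriv_bounds[OF \<Phi> K] by metis
  define M where "M = max M1 M2"
  have M: "M > 0" "\<And>p. p \<in> K \<Longrightarrow> norm (F p) \<le> M" "\<And>p. p \<in> K \<Longrightarrow> norm (F' p) \<le> M"
    "\<And>p. p \<in> K \<Longrightarrow> norm (\<Phi>' p) \<le> M"
    using M1 M2 by (fastforce simp: M_def le_max_iff_disj)+
  \<comment> \<open>A linearization error \<open>\<eta>\<close> makes \<open>w i\<close> and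
    \<open>F (q i)\<close> differ by at most \<open>\<eta> * \<kappa>\<close> in the Gronwall
    estimate below. The value of \<open>\<eta>\<close> makes the total error exactly
    \<open>\<epsilon>\<close>.\<close>
  define \<kappa> where "\<kappa> = T * M * exp (M * T)"
  define \<eta> where "\<eta> = \<epsilon> / (T * M * (\<kappa> + 1))"
  have \<kappa>: "\<kappa> > 0" using T M by (simp add: \<kappa>_def)
  have \<eta>: "\<eta> > 0" using T M \<kappa> \<epsilon> by (simp add: \<eta>_def add_pos_pos)
  obtain r1 where r1: "r1 > 0"
    "\<And>p v. p \<in> K \<Longrightarrow> norm v \<le> r1 \<Longrightarrow> p + v \<in> \<Omega> \<and> norm (F (p + v) - F p - F' p v) \<le> \<eta> * norm v"
    using C1_deriv_uniform_linearization[OF F \<Omega> K \<eta>] by metis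
  obtain r2 where r2: "r2 > 0"
    "\<And>p v. p \<in> K \<Longrightarrow> norm v \<le> r2 \<Longrightarrow> p + v \<in> \<Omega> \<and> norm (\<Phi> (p + v) - \<Phi> p - \<Phi>' p v) \<le> \<eta> * norm v"
    using C1_deriv_uniform_linearization[OF \<Phi> \<Omega> K \<eta>] by metis
  define r where "r = min r1 r2"
  have r: "r > 0" using r1 r2 by (simp add: r_def)
  obtain N0 where N0: "T * M / r < real N0" using reals_Archimedean2 by blast
  have N0': "N0 > 0"
    using order.strict_trans1[OF _ N0, of 0] T M r by simp
  show thesis
  proof (rule that[OF N0'])
    fix N p assume N: "N \<ge> N0" and qK: "\<forall>j\<le>N. euler (T / real N) F j p \<in> K"
    define h where "h = T / real N"
    define q where "q i = euler h F i p" for i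
    define w where "w i = euler_deriv h F F' i p (F p)" for i
    have qK: "q j \<in> K" if "j \<le> N" for j using that qK by (simp add: q_def h_def)
    have Npos: "N > 0" using N N0' by simp
    have h: "h > 0" and Nh: "real N * h = T" using T Npos by (auto simp: h_def)
    have "T * M / r < real N" using N N0 by linarith
    then have hM: "M * h \<le> r" using r Npos by (simp add: h_def field_simps)
    have nv: "norm (h *\<^sub>R F (q j)) \<le> h * M" if "j \<le> N" for j
      using M(2)[OF qK[OF that]] h by simp
    have q_Suc: "q (Suc j) = q j + h *\<^sub>R F (q j)" for j by (simp add: q_def)
    have rF: "norm (F (q (Suc j)) - F (q j) - h *\<^sub>R F' (q j) (F (q j))) \<le> \<eta> * (h * M)"
     and r\<Phi>: "norm (\<Phi> (q (Suc j)) - \<Phi> (q j) - h *\<^sub>R \<Phi>' (q j) (F (q j))) \<le> \<eta> * (h * M)" if "j \<le> N" for j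
    proof -
      have "norm (h *\<^sub>R F (q j)) \<le> r1" "norm (h *\<^sub>R F (q j)) \<le> r2"
        using nv[OF that] hM by (auto simp: r_def algebra_simps)
      then have "norm (F (q (Suc j)) - F (q j) - h *\<^sub>R F' (q j) (F (q j))) \<le> \<eta> * norm (h *\<^sub>R F (q j))"
        "norm (\<Phi> (q (Suc j)) - \<Phi> (q j) - h *\<^sub>R \<Phi>' (q j) (F (q j))) \<le> \<eta> * norm (h *\<^sub>R F (q j))"
        using r1(2)[OF qK[OF that]] r2(2)[OF qK[OF that]] unfolding q_Suc
        by (metis blinfun.scaleR_right)+
      moreover have "\<eta> * norm (h *\<^sub>R F (q j)) \<le> \<eta> * (h * M)"
        using nv[OF that] \<eta> by (intro mult_left_mono) auto
      ultimately show "norm (F (q (Suc j)) - F (q j) - h *\<^sub>R F' (q j) (F (q j))) \<le> \<eta> * (h * M)"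
        "norm (\<Phi> (q (Suc j)) - \<Phi> (q j) - h *\<^sub>R \<Phi>' (q j) (F (q j))) \<le> \<eta> * (h * M)" by linarith+
    qed
    have \<eta>\<kappa>: "\<eta> * \<kappa> = real N * (\<eta> * (h * M)) * exp (h * M * real N)"
      by (simp add: \<kappa>_def Nh[symmetric] algebra_simps)
    \<comment> \<open>Both sequences start at \<open>F p\<close>. The first solves the linear
      recursion with the matrices \<open>F' (q i)\<close> exactly, the second up to the
      linearization error \<open>rF\<close>, so Gronwall bounds the difference.\<close>
    have d: "norm (w i - F (q i)) \<le> \<eta> * \<kappa>" if "i \<le> N" for i
      unfolding \<eta>\<kappa>
    proof (rule discrete_gronwall[OF _ _ _ _ that, where a = "\<lambda>i. norm (w i - F (q i))"], goal_cases)
      case (4 i)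
      have "w (Suc i) - F (q (Suc i)) = (w i - F (q i)) + h *\<^sub>R F' (q i) (w i - F (q i))
              - (F (q (Suc i)) - F (q i) - h *\<^sub>R F' (q i) (F (q i)))"
        by (simp add: w_def q_def blinfun.bilinear_simps algebra_simps)
      also have "norm \<dots> \<le> norm (w i - F (q i)) + norm (h *\<^sub>R F' (q i) (w i - F (q i)))
              + norm (F (q (Suc i)) - F (q i) - h *\<^sub>R F' (q i) (F (q i)))"
        by (meson add_right_mono norm_triangle_ineq norm_triangle_ineq4 order_trans)
      also have "\<dots> \<le> norm (w i - F (q i)) + h * (M * norm (w i - F (q i))) + \<eta> * (h * M)"
      proof -
        have i: "i \<le> N" using 4(1) by simp
        have "norm (F' (q i) (w i - F (q i))) \<le> M * norm (w i - F (q i))"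
          by (rule order_trans[OF norm_blinfun mult_right_mono[OF M(3)[OF qK[OF i]] norm_ge_zero]])
        then have "h * norm (F' (q i) (w i - F (q i))) \<le> h * (M * norm (w i - F (q i)))"
          using h by (intro mult_left_mono) auto
        then show ?thesis
          unfolding norm_scaleR abs_of_pos[OF h] using rF[OF i] by linarith
      qed
      finally show ?case by (simp add: algebra_simps)
    qed (use \<eta> M h in \<open>auto simp: q_def w_def id_blinfun.rep_eq\<close>)
    define a where "a i = \<Phi> (q i)" for i
    \<comment> \<open>The term with \<open>\<kappa>\<close> comes from replacing \<open>w i\<close>
      by \<open>F (q i)\<close>, the summand 1 from linearizing \<open>\<Phi>\<close> over one Euler
      step.\<close>
    have err: "\<bar>h * \<Phi>' (q i) (w i) - (a (Suc i) - a i)\<bar> \<le> h * (\<eta> * M * (\<kappa> + 1))" if "i < N" for i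
    proof -
      have "\<bar>\<Phi>' (q i) (w i - F (q i))\<bar> \<le> M * norm (w i - F (q i))"
        using order_trans[OF norm_blinfun mult_right_mono[OF M(4)[OF qK] norm_ge_zero]] that
        by (metis less_imp_le real_norm_def)
      also have "\<dots> \<le> M * (\<eta> * \<kappa>)" using d[of i] that M by (intro mult_left_mono) auto
      finally have "h * \<bar>\<Phi>' (q i) (w i - F (q i))\<bar> \<le> h * (M * (\<eta> * \<kappa>))"
        using h by (intro mult_left_mono) auto
      moreover have "h * \<bar>\<Phi>' (q i) (w i - F (q i))\<bar> = \<bar>h * \<Phi>' (q i) (w i) - h * \<Phi>' (q i) (F (q i))\<bar>"
        using h by (simp add: abs_mult blinfun.diff_right flip: right_diff_distrib)
      ultimately show ?thesis using r\<Phi>[of i] that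
        by (simp add: a_def algebra_simps)
    qed
    let ?c = "\<lambda>j. (real N - 1 - real j) / real N"
    have c: "\<bar>?c j\<bar> \<le> 1" if "j < N" for j using that by (auto simp: field_simps)
    have parts: "(\<Sum>j<N. ?c j * (a (Suc j) - a j)) = (\<Sum>j<N. a j) / real N - a 0"
      using sum_by_parts_linear_weight[of "real N" a N] Npos
      by (simp add: sum_divide_distrib[symmetric] field_simps)
    have "(\<Phi> p + h * (\<Sum>j<N. ?c j * \<Phi>' (q j) (w j)) - (\<Sum>j<N. \<Phi> (q j)) / real N)
        = (\<Sum>j<N. ?c j * (h * \<Phi>' (q j) (w j))) - (\<Sum>j<N. ?c j * (a (Suc j) - a j))"
      unfolding parts by (simp add: a_def q_def sum_distrib_left algebra_simps)
    also have "\<dots> = (\<Sum>j<N. ?c j * (h * \<Phi>' (q j) (w j) - (a (Suc j) - a j)))"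
      by (simp only: right_diff_distrib sum_subtractf)
    also have "\<bar>\<dots>\<bar> \<le> (\<Sum>j<N. h * (\<eta> * M * (\<kappa> + 1)))"
    proof (rule order_trans[OF sum_abs sum_mono])
      fix j assume "j \<in> {..<N}"
      then have "\<bar>?c j\<bar> * \<bar>h * \<Phi>' (q j) (w j) - (a (Suc j) - a j)\<bar> \<le> 1 * (h * (\<eta> * M * (\<kappa> + 1)))"
        by (intro mult_mono c err) auto
      then show "\<bar>?c j * (h * \<Phi>' (q j) (w j) - (a (Suc j) - a j))\<bar> \<le> h * (\<eta> * M * (\<kappa> + 1))"
        by (simp only: abs_mult mult_1)
    qed
    also have "\<dots> = (real N * h) * (\<eta> * M * (\<kappa> + 1))" by simp
    also have "\<dots> = \<eta> * (T * M * (\<kappa> + 1))" unfolding Nh by simp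
    also have "\<dots> = \<epsilon>" unfolding \<eta>_def using T M \<open>\<kappa> > 0\<close> by simp
    finally show "\<bar>\<Phi> p + T / real N * (\<Sum>j<N. (real N - 1 - real j) / real N *
           \<Phi>' (euler (T / real N) F j p) (euler_deriv (T / real N) F F' j p (F p)))
         - (\<Sum>j<N. \<Phi> (euler (T / real N) F j p)) / real N\<bar> \<le> \<epsilon>"
      unfolding w_def q_def h_def .
  qed
qed

text \<open>
  By compactness finitely many of the times \<open>t\<close> suffice, and an orbit is cut into pieces of these
  lengths. The continuity in the initial point needed for this comes from the Euler iterates.
\<close>

lemma orbit_growth_bound:
  fixes F :: "'a::euclidean_space \<Rightarrow> 'a" and \<Phi> :: "'a \<Rightarrow> real"
  assumes F: "C1_deriv \<Omega> F F'" and \<Phi>: "C1_deriv \<Omega> \<Phi> \<Phi>'"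
    and \<Omega>: "open \<Omega>" and K: "compact K" "K \<subseteq> \<Omega>"
    and hyp: "\<And>p. p \<in> K \<Longrightarrow> \<exists>X I t. orbit_in K F \<Phi> X I \<and> X 0 = p \<and> t > 0 \<and> I t < \<mu> * t"
  obtains C where "\<And>X I T. orbit_in K F \<Phi> X I \<Longrightarrow> T \<ge> 0 \<Longrightarrow> I T \<le> \<mu> * T + C"
proof -
  have "\<exists>t S. t > 0 \<and> open S \<and> p \<in> S \<and> (\<forall>X I. orbit_in K F \<Phi> X I \<longrightarrow> X 0 \<in> S \<longrightarrow> I t < \<mu> * t)"
    if p: "p \<in> K" for p
  proof -
    obtain X I t where orb: "orbit_in K F \<Phi> X I" and X0: "X 0 = p" and t: "t > 0" "I t < \<mu> * t"
      using hyp[OF p] by blast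
    \<comment> \<open>Three of the four quarters are spent: Euler error at the neighbouring orbit,
      continuity of \<open>g\<close>, Euler error at \<open>p\<close>. The fourth keeps the
      inequality strict.\<close>
    define \<epsilon> where "\<epsilon> = (\<mu> * t - I t) / 4"
    have \<epsilon>: "\<epsilon> > 0" using t by (simp add: \<epsilon>_def)
    obtain N :: nat where N: "N > 0"
      "\<And>n X I j. n \<ge> N \<Longrightarrow> orbit_in K F \<Phi> X I \<Longrightarrow> j \<le> n \<Longrightarrow>
        euler (t / n) F j (X 0) \<in> \<Omega> \<and> dist (euler (t / n) F j (X 0)) (X (j * (t / n))) \<le> \<epsilon>"
      "\<And>n X I. n \<ge> N \<Longrightarrow> orbit_in K F \<Phi> X I \<Longrightarrow>
        \<bar>I t - t / n * (\<Sum>j<n. \<Phi> (euler (t / n) F j (X 0)))\<bar> \<le> \<epsilon>"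
      by (rule euler_orbit_approx[OF F \<Phi> \<Omega> K t(1) \<epsilon>]) (rule that)
    note N = N(2,3)[OF order_refl]
    define g where "g q = t / N * (\<Sum>j<N. \<Phi> (euler (t / N) F j q))" for q
    \<comment> \<open>\<open>g\<close> is the Euler approximation of \<open>I t\<close> as a
      function of the initial point. It is continuous on an open domain, so \<open>S\<close> is an
      open neighbourhood of \<open>p\<close>.\<close>
    define S where "S = euler_dom (t / N) F \<Omega> N \<inter> g -` {..<g p + \<epsilon>}"
    have op: "open (euler_dom (t / N) F \<Omega> N)" using euler_C1_deriv[OF F \<Omega>] by blast
    have "continuous_on (euler_dom (t / N) F \<Omega> N) (\<lambda>q. \<Phi> (euler (t / N) F j q))" if "j < N" for j
    proof -
      have "continuous_on (euler_dom (t / N) F \<Omega> N) (euler (t / N) F j)"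
        using euler_C1_deriv[OF F \<Omega>, of "t / N" j] that
        by (auto intro!: continuous_on_subset[OF C1_deriv_continuous_on] simp: euler_dom_def)
      then show ?thesis
        using that by (auto intro!: continuous_on_compose2[OF C1_deriv_continuous_on[OF \<Phi>]] simp: euler_dom_def)
    qed
    then have "continuous_on (euler_dom (t / N) F \<Omega> N) g"
      unfolding g_def by (intro continuous_intros) auto
    then have "open S"
      unfolding S_def using op by (intro continuous_open_preimage) auto
    moreover have "p \<in> S"
      using N(1)[OF orb] X0 \<epsilon> by (auto simp: S_def euler_dom_def)
    moreover have "J t < \<mu> * t" if "orbit_in K F \<Phi> Y J" "Y 0 \<in> S" for Y J
    proof -
      have "J t \<le> g (Y 0) + \<epsilon>" using N(2)[OF that(1)] by (simp add: g_def)
      also have "g (Y 0) < g p + \<epsilon>" using that by (simp add: S_def)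
      also have "g p \<le> I t + \<epsilon>" using N(2)[OF orb] X0 by (simp add: g_def abs_diff_le_iff)
      also have "I t + \<epsilon> + \<epsilon> + \<epsilon> < \<mu> * t" using t by (simp add: \<epsilon>_def field_simps)
      finally show ?thesis by simp
    qed
    ultimately show ?thesis using t(1) by blast
  qed
  then obtain \<tau> S where \<tau>: "\<And>p. p \<in> K \<Longrightarrow> \<tau> p > 0" "\<And>p. p \<in> K \<Longrightarrow> open (S p)" "\<And>p. p \<in> K \<Longrightarrow> p \<in> S p"
    "\<And>p X I. p \<in> K \<Longrightarrow> orbit_in K F \<Phi> X I \<Longrightarrow> X 0 \<in> S p \<Longrightarrow> I (\<tau> p) < \<mu> * \<tau> p"
    by metis
  obtain D where D: "D \<subseteq> K" "finite D" "K \<subseteq> (\<Union>p\<in>D. S p)"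
    using compactE_image[OF K(1), of K S] \<tau>(2,3) by blast
  \<comment> \<open>\<open>insert 1\<close> keeps \<open>Min\<close> and \<open>Max\<close>
    meaningful when \<open>D\<close> is empty. A positive lower bound on the lengths makes the
    cutting terminate; the upper bound controls the last piece.\<close>
  define t0 t1 where "t0 = Min (insert 1 (\<tau> ` D))" and "t1 = Max (insert 1 (\<tau> ` D))"
  have t0: "t0 > 0" unfolding t0_def using D \<tau>(1) by (subst Min_gr_iff) auto
  have t01: "t0 \<le> \<tau> p" "\<tau> p \<le> t1" if "p \<in> D" for p
    using that D by (auto simp: t0_def t1_def)
  have t1: "t1 \<ge> 1" using D by (simp add: t1_def)
  obtain M where M: "M > 0" "\<And>p. p \<in> K \<Longrightarrow> norm (\<Phi> p) \<le> M"
    using C1_deriv_bounds[OF \<Phi> K] by metis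
  define C where "C = (M + \<bar>\<mu>\<bar>) * t1"
  \<comment> \<open>Each removed piece has length at least \<open>t0\<close>, so \<open>n\<close>
    bounds the number of pieces. A remainder of length at most \<open>t1\<close> costs at most
    \<open>C\<close>, by \<open>\<bar>\<Phi>\<bar> \<le> M\<close> on \<open>K\<close>.\<close>
  have "I T \<le> \<mu> * T + C" if "orbit_in K F \<Phi> X I" "T \<ge> 0" "T \<le> real n * t0" for X I T n
    using that
  proof (induction n arbitrary: X I T)
    case 0
    then show ?case using M t1 by (auto simp: orbit_in_def C_def)
  next
    case (Suc n)
    show ?case
    proof (cases "T \<le> t1")
      case True
      have "norm (I T - I 0 - (T - 0) *\<^sub>R 0) \<le> M * (T - 0)"
        by (rule vector_derivative_bound[where f'="\<lambda>u. \<Phi> (X u)"])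
          (use Suc.prems M in \<open>auto simp: orbit_in_def intro: has_vector_derivative_within_subset\<close>)
      then have "I T \<le> M * T" using Suc.prems by (simp add: orbit_in_def)
      moreover have "(M - \<mu>) * T \<le> (M + \<bar>\<mu>\<bar>) * t1"
        using M Suc.prems True by (intro mult_mono) auto
      ultimately show ?thesis by (simp add: C_def algebra_simps)
    next
      case False
      have "X 0 \<in> K" using Suc.prems by (simp add: orbit_in_def)
      then obtain p where p: "p \<in> D" "X 0 \<in> S p" using D by blast
      then have pK: "p \<in> K" using D by auto
      define s where "s = \<tau> p"
      have s: "s > 0" "s < T" "t0 \<le> s" using t01[OF p(1)] False \<tau>(1)[OF pK] by (auto simp: s_def)
      have "I s < \<mu> * s" using \<tau>(4)[OF pK Suc.prems(1) p(2)] by (simp add: s_def)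
      moreover have "I (T - s + s) - I s \<le> \<mu> * (T - s) + C"
        using Suc.IH[OF orbit_in_shift[OF Suc.prems(1)], of s "T - s"] s Suc.prems
        by (simp add: algebra_simps)
      ultimately show ?thesis by (simp add: algebra_simps)
    qed
  qed
  then show thesis
    using that[of C] t0 by (metis less_imp_le mult.commute pos_divide_less_eq reals_Archimedean2)
qed

section \<open>Construction of the auxiliary function\<close>

text \<open>Three errors of \<open>\<epsilon> / 4\<close> occur: the variation formula, the
  comparison of the Euler average with \<open>I T / T\<close>, and \<open>C / T\<close>. The domain
  is named as \<open>euler_dom h F \<Omega> N\<close> in the conclusion so that it can later be seen
  to contain more than a neighbourhood of \<open>K\<close>.\<close>

lemma auxiliary_function_exists:
  fixes F :: "'a::euclidean_space \<Rightarrow> 'a" and \<Phi> :: "'a \<Rightarrow> real"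
  assumes F: "C1_deriv \<Omega> F F'" and \<Phi>: "C1_deriv \<Omega> \<Phi> \<Phi>'"
    and \<Omega>: "open \<Omega>" and K: "compact K" "K \<subseteq> \<Omega>"
    and hyp: "\<And>p. p \<in> K \<Longrightarrow> \<exists>X I t. orbit_in K F \<Phi> X I \<and> X 0 = p \<and> t > 0 \<and> I t < \<mu> * t"
    and \<epsilon>: "\<epsilon> > 0"
  obtains h N V V' where "C1_deriv (euler_dom h F \<Omega> N) V V'" "K \<subseteq> euler_dom h F \<Omega> N"
    "\<And>p. p \<in> K \<Longrightarrow> \<Phi> p + blinfun_apply (V' p) (F p) \<le> \<mu> + \<epsilon>"
proof -
  obtain C where C: "\<And>X I T. orbit_in K F \<Phi> X I \<Longrightarrow> T \<ge> 0 \<Longrightarrow> I T \<le> \<mu> * T + C"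
    using orbit_growth_bound[OF F \<Phi> \<Omega> K hyp] by metis
  obtain \<delta> where \<delta>: "\<delta> > 0" "(\<Union>x\<in>K. cball x \<delta>) \<subseteq> \<Omega>"
    using compact_subset_open_imp_cball_epsilon_subset[OF K(1) \<Omega> K(2)] by metis
  let ?K = "\<Union>x\<in>K. cball x \<delta>"
  have cK: "compact ?K" using compact_minkowski_sum_cball[OF K(1)] by simp
  define T where "T = 4 * (\<bar>C\<bar> + 1) / \<epsilon>"
  have T: "T > 0" "C / T \<le> \<epsilon> / 4"
  proof -
    show "T > 0" using \<epsilon> by (simp add: T_def)
    have "C * \<epsilon> \<le> (\<bar>C\<bar> + 1) * \<epsilon>" using \<epsilon> by (intro mult_right_mono) auto
    then show "C / T \<le> \<epsilon> / 4" using \<epsilon> by (simp add: T_def field_simps)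
  qed
  \<comment> \<open>\<open>\<delta>\<close> keeps the Euler iterates in the compact neighbourhood
    \<open>?K\<close>; the other entry becomes \<open>\<epsilon> / 4\<close> after division by
    \<open>T\<close>.\<close>
  have m: "min \<delta> (\<epsilon> / 4 * T) > 0" using \<delta> T \<epsilon> by simp
  obtain N1 :: nat where N1: "N1 > 0"
    "\<And>N X I j. N \<ge> N1 \<Longrightarrow> orbit_in K F \<Phi> X I \<Longrightarrow> j \<le> N \<Longrightarrow>
      euler (T / N) F j (X 0) \<in> \<Omega> \<and> dist (euler (T / N) F j (X 0)) (X (j * (T / N))) \<le> min \<delta> (\<epsilon> / 4 * T)"
    "\<And>N X I. N \<ge> N1 \<Longrightarrow> orbit_in K F \<Phi> X I \<Longrightarrow>
      \<bar>I T - T / N * (\<Sum>j<N. \<Phi> (euler (T / N) F j (X 0)))\<bar> \<le> min \<delta> (\<epsilon> / 4 * T)"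
    by (rule euler_orbit_approx[OF F \<Phi> \<Omega> K T(1) m]) (rule that)
  have e4: "\<epsilon> / 4 > 0" using \<epsilon> by simp
  \<comment> \<open>The variation formula is taken on \<open>?K\<close>, since Euler iterates that
    start in \<open>K\<close> can leave \<open>K\<close>.\<close>
  obtain N2 :: nat where N2: "N2 > 0"
    "\<And>N p. N \<ge> N2 \<Longrightarrow> \<forall>j\<le>N. euler (T / real N) F j p \<in> ?K \<Longrightarrow>
      \<bar>\<Phi> p + T / real N * (\<Sum>j<N. (real N - 1 - real j) / real N *
           \<Phi>' (euler (T / real N) F j p) (euler_deriv (T / real N) F F' j p (F p)))
         - (\<Sum>j<N. \<Phi> (euler (T / real N) F j p)) / real N\<bar> \<le> \<epsilon> / 4"
    by (rule euler_variation[OF F \<Phi> \<Omega> cK \<delta>(2) T(1) e4]) (rule that)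
  define N where "N = max N1 N2"
  define h where "h = T / real N"
  let ?c = "\<lambda>j. (real N - 1 - real j) / real N"
  \<comment> \<open>A Riemann sum for the integral with weight \<open>1 - t / T\<close>, the weight
    being sampled at the right end \<open>(j + 1) * h\<close> of each step.\<close>
  define V where "V p = h * (\<Sum>j<N. ?c j * \<Phi> (euler h F j p))" for p
  define V' where "V' p = h *\<^sub>R (\<Sum>j<N. ?c j *\<^sub>R (\<Phi>' (euler h F j p) o\<^sub>L euler_deriv h F F' j p))" for p
  have N: "N \<ge> N1" "N \<ge> N2" "N > 0" using N1(1) by (auto simp: N_def)
  have h: "h > 0" using T N by (simp add: h_def)
  let ?D = "euler_dom h F \<Omega> N"
  have orb: "\<exists>X I. orbit_in K F \<Phi> X I \<and> X 0 = p" if "p \<in> K" for p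
    using hyp[OF that] by blast
  have inD: "K \<subseteq> ?D"
  proof
    fix p assume "p \<in> K"
    from orb[OF this] obtain X I where "orbit_in K F \<Phi> X I" "X 0 = p" by blast
    then show "p \<in> ?D" using N1(2)[OF N(1), of X I] by (simp add: euler_dom_def h_def)
  qed
  have ED: "euler h F j p \<in> \<Omega>" if "j < N" "p \<in> ?D" for j p
    using that by (simp add: euler_dom_def)
  have E: "C1_deriv ?D (euler h F j) (euler_deriv h F F' j)" if "j < N" for j
  proof (rule C1_deriv_subset)
    show "C1_deriv (euler_dom h F \<Omega> j) (euler h F j) (euler_deriv h F F' j)"
      using euler_C1_deriv[OF F \<Omega>] by blast
    show "?D \<subseteq> euler_dom h F \<Omega> j" using that by (auto simp: euler_dom_def)
  qed
  have "(V has_derivative blinfun_apply (V' p)) (at p)" if p: "p \<in> ?D" for p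
  proof -
    have "((\<lambda>p. \<Phi> (euler h F j p)) has_derivative (\<lambda>v. \<Phi>' (euler h F j p) (euler_deriv h F F' j p v))) (at p)"
      if "j < N" for j
    proof -
      have "(euler h F j has_derivative euler_deriv h F F' j p) (at p)"
        using E[OF that] p by (simp add: C1_deriv_def)
      moreover have "(\<Phi> has_derivative \<Phi>' (euler h F j p)) (at (euler h F j p))"
        using \<Phi> ED[OF that p] by (simp add: C1_deriv_def)
      ultimately show ?thesis by (rule has_derivative_compose)
    qed
    then have "(V has_derivative (\<lambda>v. h * (\<Sum>j<N. ?c j * \<Phi>' (euler h F j p) (euler_deriv h F F' j p v)))) (at p)"
      unfolding V_def by (intro has_derivative_mult_right has_derivative_sum) auto
    moreover have "blinfun_apply (V' p) = (\<lambda>v. h * (\<Sum>j<N. ?c j * \<Phi>' (euler h F j p) (euler_deriv h F F' j p v)))"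
      by (rule ext) (simp add: V'_def blinfun.sum_left blinfun.scaleR_left)
    ultimately show ?thesis by simp
  qed
  moreover have "continuous_on ?D V'"
  proof -
    have "continuous_on ?D (\<lambda>p. \<Phi>' (euler h F j p) o\<^sub>L euler_deriv h F F' j p)" if "j < N" for j
    proof (rule bounded_bilinear.continuous_on[OF bounded_bilinear_blinfun_compose])
      have "continuous_on \<Omega> \<Phi>'" using \<Phi> by (simp add: C1_deriv_def)
      then show "continuous_on ?D (\<lambda>p. \<Phi>' (euler h F j p))"
        by (rule continuous_on_compose2[OF _ C1_deriv_continuous_on[OF E[OF that]]]) (use ED[OF that] in auto)
      show "continuous_on ?D (euler_deriv h F F' j)"
        using E[OF that] by (simp add: C1_deriv_def)
    qed
    then show ?thesis unfolding V'_def
      by (intro continuous_on_scaleR continuous_on_const continuous_on_sum) auto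
  qed
  ultimately have VC1: "C1_deriv ?D V V'" by (simp add: C1_deriv_def)
  show thesis
  proof (rule that[OF VC1 inD])
    fix p assume "p \<in> K"
    from orb[OF this] obtain X I where X: "orbit_in K F \<Phi> X I" "X 0 = p" by blast
    have inK: "euler h F j p \<in> ?K" if "j \<le> N" for j
    proof -
      have "X (j * h) \<in> K" using X h by (simp add: orbit_in_def)
      then show ?thesis using N1(2)[OF N(1) X(1) that] X(2) by (intro UN_I[of "X (j * h)"]) (simp_all add: h_def dist_commute)
    qed
    let ?A = "(\<Sum>j<N. \<Phi> (euler h F j p)) / N"
    have "blinfun_apply (V' p) (F p) = h * (\<Sum>j<N. ?c j * \<Phi>' (euler h F j p) (euler_deriv h F F' j p (F p)))"
      by (simp add: V'_def blinfun.sum_left blinfun.scaleR_left)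
    moreover have "\<bar>\<Phi> p + h * (\<Sum>j<N. ?c j * \<Phi>' (euler h F j p) (euler_deriv h F F' j p (F p))) - ?A\<bar> \<le> \<epsilon> / 4"
      using N2(2)[OF N(2), of p] inK unfolding h_def by blast
    ultimately have 1: "\<Phi> p + blinfun_apply (V' p) (F p) \<le> ?A + \<epsilon> / 4" by linarith
    have "\<bar>I T - T * ?A\<bar> \<le> \<epsilon> / 4 * T"
      using N1(3)[OF N(1) X(1)] X(2) by (simp add: h_def)
    then have "T * ?A \<le> I T + \<epsilon> / 4 * T" by linarith
    also have "\<dots> \<le> \<mu> * T + C + \<epsilon> / 4 * T" using C[OF X(1), of T] T by simp
    also have "\<dots> \<le> T * (\<mu> + \<epsilon> / 4 + \<epsilon> / 4)"
      using T by (simp add: field_simps)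
    finally have "?A \<le> \<mu> + \<epsilon> / 4 + \<epsilon> / 4" using T(1) by (simp only: mult_le_cancel_left_pos)
    with 1 \<epsilon> show "\<Phi> p + blinfun_apply (V' p) (F p) \<le> \<mu> + \<epsilon>" by simp
  qed
qed

section \<open>Linear differential equations\<close>

lemma nonneg_derivative_imp_le:
  fixes \<phi> :: "real \<Rightarrow> real"
  assumes "\<And>s. s \<ge> 0 \<Longrightarrow> (\<phi> has_vector_derivative \<phi>' s) (at s within {0..})"
    "\<And>s. s \<ge> 0 \<Longrightarrow> s \<le> t \<Longrightarrow> \<phi>' s \<ge> 0" "t \<ge> 0"
  shows "\<phi> 0 \<le> \<phi> t"
proof -
  have "\<exists>x\<in>{0..t}. \<phi> t - \<phi> 0 = (t - 0) *\<^sub>R \<phi>' x"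
  proof (rule mvt_very_simple)
    fix x assume "0 \<le> x" "x \<le> t"
    then have "(\<phi> has_vector_derivative \<phi>' x) (at x within {0..t})"
      by (intro has_vector_derivative_within_subset[OF assms(1)]) auto
    then show "(\<phi> has_derivative (\<lambda>h. h *\<^sub>R \<phi>' x)) (at x within {0..t})"
      by (simp add: has_vector_derivative_def)
  qed (use assms in auto)
  then obtain x where "x \<in> {0..t}" "\<phi> t - \<phi> 0 = t * \<phi>' x" by auto
  moreover from this have "0 \<le> t * \<phi>' x" using assms(2)[of x] assms(3) by simp
  ultimately show ?thesis by linarith
qed

lemma derivative_le_imp_le_linear:
  fixes \<phi> :: "real \<Rightarrow> real"
  assumes "\<And>s. s \<ge> 0 \<Longrightarrow> (\<phi> has_vector_derivative \<phi>' s) (at s within {0..})"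
    "\<And>s. s \<ge> 0 \<Longrightarrow> \<phi>' s \<le> c" "t \<ge> 0"
  shows "\<phi> t \<le> \<phi> 0 + c * t"
proof -
  have "c * 0 - \<phi> 0 \<le> c * t - \<phi> t"
  proof (rule nonneg_derivative_imp_le[where \<phi>'="\<lambda>s. c - \<phi>' s"])
    fix s :: real assume "s \<ge> 0"
    from assms(1)[OF this]
    show "((\<lambda>t. c * t - \<phi> t) has_vector_derivative c - \<phi>' s) (at s within {0..})"
      by (auto intro!: derivative_eq_intros)
  qed (use assms in auto)
  then show ?thesis by simp
qed

text \<open>On \<open>[0, t]\<close> the operators are bounded by some \<open>c\<close>, so
  \<open>exp (2 * c * s) * (y s \<bullet> y s)\<close> is nondecreasing in \<open>s\<close> and
  stays positive.\<close>

lemma linear_ode_nonzero: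
  fixes y :: "real \<Rightarrow> 'a::real_inner"
  assumes "bounded_bilinear pr"
    and A: "continuous_on {0..} A"
    and y: "\<And>t. t \<ge> 0 \<Longrightarrow> (y has_vector_derivative pr (A t) (y t)) (at t within {0..})"
    and y0: "y 0 \<noteq> 0" and t: "t \<ge> 0"
  shows "y t \<noteq> 0"
proof -
  interpret bounded_bilinear pr by fact
  obtain K where K: "\<And>a b. norm (pr a b) \<le> norm a * norm b * K" "K > 0"
    using pos_bounded by blast
  have "compact (A ` {0..t})"
    using A by (auto intro!: compact_continuous_image intro: continuous_on_subset)
  from compact_imp_bounded[OF this] obtain M where M: "\<And>s. s \<in> {0..t} \<Longrightarrow> norm (A s) \<le> M"
    unfolding bounded_iff by (metis imageI)
  define c where "c = M * K"
  have c: "norm (pr (A s) v) \<le> c * norm v" if "s \<in> {0..t}" for s v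
  proof -
    have "norm (A s) * (norm v * K) \<le> M * (norm v * K)"
      using M[OF that] K by (intro mult_right_mono) auto
    then show ?thesis using K(1)[of "A s" v] by (simp add: c_def mult_ac)
  qed
  define \<phi> where "\<phi> s = exp (2 * c * s) * (y s \<bullet> y s)" for s
  have "\<phi> 0 \<le> \<phi> t"
  proof (rule nonneg_derivative_imp_le[where \<phi>'="\<lambda>s. exp (2 * c * s) * (2 * c * (y s \<bullet> y s) + 2 * (pr (A s) (y s) \<bullet> y s))"])
    fix s :: real assume s: "s \<ge> 0"
    have "((\<lambda>s. exp (2 * c * s)) has_vector_derivative (exp (2 * c * s) * (2 * c))) (at s within {0..})"
      unfolding has_real_derivative_iff_has_vector_derivative[symmetric]
      by (auto intro!: derivative_eq_intros)
    moreover have "((\<lambda>s. y s \<bullet> y s) has_vector_derivative (y s \<bullet> pr (A s) (y s) + pr (A s) (y s) \<bullet> y s)) (at s within {0..})"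
      by (rule bounded_bilinear.has_vector_derivative[OF bounded_bilinear_inner y y]) fact+
    ultimately have "(\<phi> has_vector_derivative exp (2 * c * s) * (y s \<bullet> pr (A s) (y s) + pr (A s) (y s) \<bullet> y s)
        + (exp (2 * c * s) * (2 * c)) * (y s \<bullet> y s)) (at s within {0..})"
      unfolding \<phi>_def by (rule has_vector_derivative_mult)
    then show "(\<phi> has_vector_derivative exp (2 * c * s) * (2 * c * (y s \<bullet> y s) + 2 * (pr (A s) (y s) \<bullet> y s))) (at s within {0..})"
      by (simp add: algebra_simps inner_commute)
    assume "s \<le> t"
    then have "norm (pr (A s) (y s)) * norm (y s) \<le> c * norm (y s) * norm (y s)"
      using s by (intro mult_right_mono c) auto
    moreover have "\<bar>pr (A s) (y s) \<bullet> y s\<bar> \<le> norm (pr (A s) (y s)) * norm (y s)"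
      by (rule Cauchy_Schwarz_ineq2)
    ultimately have "c * (y s \<bullet> y s) + (pr (A s) (y s) \<bullet> y s) \<ge> 0"
      by (simp add: power2_norm_eq_inner[symmetric] power2_eq_square mult_ac)
    then show "exp (2 * c * s) * (2 * c * (y s \<bullet> y s) + 2 * (pr (A s) (y s) \<bullet> y s)) \<ge> 0"
      by (intro mult_nonneg_nonneg) auto
  qed (use t in auto)
  moreover have "\<phi> 0 > 0" using y0 by (simp add: \<phi>_def)
  ultimately have "\<phi> t > 0" by simp
  then show ?thesis by (auto simp: \<phi>_def)
qed

text \<open>Picard iteration; \<open>f n\<close> is the difference of two successive iterates.\<close>

lemma linear_ode_solution_exists:
  fixes pr :: "'c::real_normed_vector \<Rightarrow> 'a::banach \<Rightarrow> 'a"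
  assumes "bounded_bilinear pr"
    and A: "continuous_on {0..} A" and bdd: "bounded (A ` {0..})"
  obtains y where "y 0 = y0"
    "\<And>t. t \<ge> 0 \<Longrightarrow> (y has_vector_derivative pr (A t) (y t)) (at t within {0..})"
proof -
  interpret bounded_bilinear pr by fact
  obtain K where K: "\<And>a b. norm (pr a b) \<le> norm a * norm b * K" "K > 0"
    using pos_bounded by blast
  obtain M where M: "\<And>s. s \<ge> 0 \<Longrightarrow> norm (A s) \<le> M" "M > 0"
    using bdd unfolding bounded_pos by auto
  define c where "c = M * K"
  have c0: "c > 0" using K M by (simp add: c_def)
  have c: "norm (pr (A s) v) \<le> c * norm v" if "s \<ge> 0" for s v
  proof -
    have "norm (A s) * (norm v * K) \<le> M * (norm v * K)"
      using M(1)[OF that] K by (intro mult_right_mono) auto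
    then show ?thesis using K(1)[of "A s" v] by (simp add: c_def mult_ac)
  qed
  define f where "f = rec_nat (\<lambda>t::real. y0) (\<lambda>_ g t. integral {0..t} (\<lambda>s. pr (A s) (g s)))"
  have f0: "f 0 t = y0" and fS: "f (Suc n) t = integral {0..t} (\<lambda>s. pr (A s) (f n s))" for n t
    by (simp_all add: f_def)
  have contA: "continuous_on {0..t} (\<lambda>s. pr (A s) (g s))" if "continuous_on {0..t} g" for g t
    using that A by (intro continuous_on) (auto intro: continuous_on_subset)
  have cont: "continuous_on {0..t} (f n)" for n t
  proof (induction n)
    case 0 then show ?case by (simp add: f0 cong: continuous_on_cong)
  next
    case (Suc n)
    have "continuous_on {0..t} (\<lambda>u. integral {0..u} (\<lambda>s. pr (A s) (f n s)))"
      by (rule indefinite_integral_continuous_1) (intro integrable_continuous_real contA Suc)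
    then show ?case by (simp add: fS[abs_def])
  qed
  \<comment> \<open>Integrating \<open>c * exp (2 * c * s)\<close> gains a factor 1/2, so the weight
    with the doubled rate makes the series geometric.\<close>
  have bound: "norm (f n t) \<le> norm y0 * exp (2 * c * t) / 2 ^ n" if "t \<ge> 0" for n t
    using that
  proof (induction n arbitrary: t)
    case 0 then show ?case using c0 mult_left_mono[of 1 "exp (2 * c * t)" "norm y0"] by (simp add: f0)
  next
    case (Suc n)
    let ?G = "\<lambda>s. norm y0 * exp (2 * c * s) / 2 ^ Suc n"
    have "(?G has_vector_derivative c * (norm y0 * exp (2 * c * s) / 2 ^ n)) (at s within {0..t})" for s
      unfolding has_real_derivative_iff_has_vector_derivative[symmetric]
      by (auto intro!: derivative_eq_intros simp: field_simps)
    then have int: "((\<lambda>s. c * (norm y0 * exp (2 * c * s) / 2 ^ n)) has_integral (?G t - ?G 0)) {0..t}"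
      using Suc.prems by (intro fundamental_theorem_of_calculus) auto
    have "norm (f (Suc n) t) \<le> integral {0..t} (\<lambda>s. c * (norm y0 * exp (2 * c * s) / 2 ^ n))"
      unfolding fS
    proof (rule integral_norm_bound_integral)
      fix s assume s: "s \<in> {0..t}"
      have "norm (pr (A s) (f n s)) \<le> c * norm (f n s)" using s by (intro c) auto
      also have "\<dots> \<le> c * (norm y0 * exp (2 * c * s) / 2 ^ n)"
        using s c0 Suc.IH[of s] by (intro mult_left_mono) auto
      finally show "norm (pr (A s) (f n s)) \<le> c * (norm y0 * exp (2 * c * s) / 2 ^ n)" .
    qed (rule integrable_continuous_real contA cont has_integral_integrable[OF int])+
    also have "\<dots> = ?G t - ?G 0" using int by (rule integral_unique)
    also have "\<dots> \<le> ?G t" by simp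
    finally show ?case .
  qed
  define y where "y t = (\<Sum>n. f n t)" for t
  define S where "S n t = (\<Sum>i<n. f i t)" for n t
  have lim: "uniform_limit {0..T} S y sequentially" for T
    unfolding S_def[abs_def] y_def[abs_def]
  proof (rule Weierstrass_m_test)
    fix n t assume t: "t \<in> {0..T}"
    have "norm y0 * exp (2 * c * t) \<le> norm y0 * exp (2 * c * T)"
      using t c0 by (intro mult_left_mono) auto
    then show "norm (f n t) \<le> norm y0 * exp (2 * c * T) * (1 / 2) ^ n"
      using bound[of t n] t by (simp add: power_divide divide_right_mono order_trans)
  next
    show "summable (\<lambda>n. norm y0 * exp (2 * c * T) * (1 / 2) ^ n)"
      by (intro summable_mult summable_geometric) simp
  qed
  have contS: "continuous_on {0..T} (S n)" for n T
    unfolding S_def by (intro continuous_on_sum cont)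
  have conty: "continuous_on {0..T} y" for T
    by (rule uniform_limit_theorem[OF _ lim]) (auto simp: contS)
  \<comment> \<open>The partial sums are the Picard iterates. On each \<open>[0, T]\<close> they
    converge uniformly, which lets the limit pass under the integral.\<close>
  have S_Suc: "S (Suc n) T = y0 + integral {0..T} (\<lambda>s. pr (A s) (S n s))" for n T
  proof -
    have "S (Suc n) T = y0 + (\<Sum>i<n. integral {0..T} (\<lambda>s. pr (A s) (f i s)))"
      unfolding S_def sum.lessThan_Suc_shift f0 fS by simp
    also have "(\<Sum>i<n. integral {0..T} (\<lambda>s. pr (A s) (f i s))) = integral {0..T} (\<lambda>s. \<Sum>i<n. pr (A s) (f i s))"
      by (intro integral_sum[symmetric]) (auto intro!: integrable_continuous_real contA cont)
    finally show ?thesis by (simp add: S_def sum_right)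
  qed
  have eq: "y T = y0 + integral {0..T} (\<lambda>s. pr (A s) (y s))" if T: "T \<ge> 0" for T
  proof -
    have "uniform_limit {0..T} (\<lambda>n s. pr (A s) (S n s)) (\<lambda>s. pr (A s) (y s)) sequentially"
    proof (rule uniform_limitI)
      fix e :: real assume "e > 0"
      then have "e / c > 0" using c0 by simp
      from uniform_limitD[OF lim[of T] this]
      show "\<forall>\<^sub>F n in sequentially. \<forall>s\<in>{0..T}. dist (pr (A s) (S n s)) (pr (A s) (y s)) < e"
      proof eventually_elim
        case (elim n)
        show ?case
        proof
          fix s assume s: "s \<in> {0..T}"
          have "dist (pr (A s) (S n s)) (pr (A s) (y s)) \<le> c * norm (S n s - y s)"
            unfolding dist_norm diff_right[symmetric] using s by (intro c) auto
          also have "\<dots> < e" using elim s c0 by (auto simp: dist_norm field_simps)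
          finally show "dist (pr (A s) (S n s)) (pr (A s) (y s)) < e" .
        qed
      qed
    qed
    from uniform_limit_integral[OF this contA[OF contS] sequentially_bot]
    obtain I J where IJ: "\<And>n. ((\<lambda>s. pr (A s) (S n s)) has_integral I n) {0..T}"
      "((\<lambda>s. pr (A s) (y s)) has_integral J) {0..T}" "I \<longlonglongrightarrow> J" by metis
    have "(\<lambda>n. S (Suc n) T) \<longlonglongrightarrow> y0 + J"
      unfolding S_Suc using IJ(1)[THEN integral_unique] IJ(3) by (auto intro!: tendsto_intros)
    moreover have "(\<lambda>n. S (Suc n) T) \<longlonglongrightarrow> y T"
      using tendsto_uniform_limitI[OF lim[of T], of T] T by (intro LIMSEQ_Suc) auto
    ultimately have "y T = y0 + J" by (metis LIMSEQ_unique)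
    then show ?thesis using IJ(2)[THEN integral_unique] by simp
  qed
  show thesis
  proof (rule that)
    show "y 0 = y0" using eq[of 0] by simp
    fix t :: real assume t: "t \<ge> 0"
    \<comment> \<open>The interval extends to \<open>t+1\<close> so that it contains a right
      neighbourhood of \<open>t\<close>, where the filters within \<open>{0..t+1}\<close> and
      \<open>{0..}\<close> agree.\<close>
    have "((\<lambda>u. y0 + integral {0..u} (\<lambda>s. pr (A s) (y s))) has_vector_derivative pr (A t) (y t)) (at t within {0..t+1})"
      using integral_has_vector_derivative[OF contA[OF conty], of t "t+1"] t
      by (auto intro!: derivative_eq_intros)
    then have "(y has_vector_derivative pr (A t) (y t)) (at t within {0..t+1})"
      by (rule has_vector_derivative_transform[rotated 2]) (use t eq in auto)
    moreover have "at t within {0..t+1} = at t within {0..}"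
      by (rule at_within_nhd[of _ "{..<t+1}"]) auto
    ultimately show "(y has_vector_derivative pr (A t) (y t)) (at t within {0..})" by simp
  qed
qed

section \<open>Gradients, \<open>Cr_open\<close> and compound matrices\<close>

text \<open>As \<open>gradient\<close> is a definite description, both existence and uniqueness of
  the vector representing \<open>g'\<close> are needed. It is assembled from the values of
  \<open>g'\<close> on the basis.\<close>

lemma gradient_inner:
  assumes "(g has_derivative g') (at x)"
  shows "u \<bullet> gradient g x = g' u"
proof -
  interpret bounded_linear g' using assms by (rule has_derivative_bounded_linear)
  define D where "D = (\<Sum>b\<in>Basis. g' b *\<^sub>R b)"
  have D: "v \<bullet> D = g' v" for v
  proof -
    have "g' v = g' (\<Sum>b\<in>Basis. (v \<bullet> b) *\<^sub>R b)" by (simp add: euclidean_representation)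
    also have "\<dots> = v \<bullet> D" by (simp add: D_def sum scaleR inner_sum_right mult.commute)
    finally show ?thesis by simp
  qed
  have "gradient g x = D"
    unfolding gradient_def
  proof (rule the_equality)
    show "GDERIV g x :> D" using assms by (simp add: gderiv_def D)
    fix E assume "GDERIV g x :> E"
    then have "(\<lambda>h. h \<bullet> E) = g'"
      using assms unfolding gderiv_def by (rule has_derivative_unique)
    then show "E = D" by (metis D vector_eq_ldot)
  qed
  then show ?thesis by (simp add: D)
qed

text \<open>Converts the two gradient terms of \<open>aux_sup\<close> into one derivative of
  \<open>V\<close> along the joint vector field, by \<open>(u, w) = (u, 0) + (0, w)\<close>.\<close>

lemma partial_gradients_inner:
  assumes "(V has_derivative V') (at (x, z))"
  shows "u \<bullet> gradient (\<lambda>x'. V (x', z)) x + w \<bullet> gradient (\<lambda>z'. V (x, z')) z = V' (u, w)"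
proof -
  interpret bounded_linear V' using assms by (rule has_derivative_bounded_linear)
  have "((\<lambda>x'. (x', z)) has_derivative (\<lambda>u. (u, 0))) (at x)"
    "((\<lambda>z'. (x, z')) has_derivative (\<lambda>w. (0, w))) (at z)"
    by (auto intro!: derivative_eq_intros)
  from has_derivative_compose[OF this(1), of V V'] has_derivative_compose[OF this(2), of V V']
  have "u \<bullet> gradient (\<lambda>x'. V (x', z)) x = V' (u, 0)" "w \<bullet> gradient (\<lambda>z'. V (x, z')) z = V' (0, w)"
    using assms by (auto intro!: gradient_inner)
  then show ?thesis by (simp flip: add)
qed

section \<open>Closure properties of \<open>Cr_open\<close> of order 1\<close>

lemma Cr_open_1I:
  assumes g: "\<And>x. x \<in> U \<Longrightarrow> (g has_derivative g' x) (at x)"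
    and cont: "\<And>v. continuous_on U (\<lambda>x. g' x v)"
  shows "Cr_open 1 U g"
proof -
  have "continuous_on U (\<lambda>x. frechet_derivative g (at x) v)" for v
    using cont[of v] by (rule continuous_on_eq) (use frechet_derivative_at[OF g] in metis)
  then show ?thesis using g by (auto simp: differentiable_def)
qed

lemma Cr_open_1D:
  assumes "Cr_open 1 U g"
  shows "x \<in> U \<Longrightarrow> (g has_derivative frechet_derivative g (at x)) (at x)"
    and "continuous_on U (\<lambda>x. frechet_derivative g (at x) v)"
    and "continuous_on U g"
proof -
  have d: "\<forall>x\<in>U. g differentiable (at x)" using assms by simp
  then show "x \<in> U \<Longrightarrow> (g has_derivative frechet_derivative g (at x)) (at x)"
    by (simp add: frechet_derivative_works)
  show "continuous_on U (\<lambda>x. frechet_derivative g (at x) v)" using assms by simp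
  show "continuous_on U g"
    using d by (intro continuous_at_imp_continuous_on) (auto intro: differentiable_imp_continuous_within)
qed

lemma Cr_open_2_iff:
  "Cr_open 2 U g \<longleftrightarrow> (\<forall>x\<in>U. g differentiable (at x)) \<and> (\<forall>v. Cr_open 1 U (\<lambda>x. frechet_derivative g (at x) v))"
  by (simp add: numeral_2_eq_2)

lemma Cr_open_2_imp_1:
  assumes "Cr_open 2 U g"
  shows "Cr_open 1 U g"
proof (rule Cr_open_1I)
  show "(g has_derivative frechet_derivative g (at x)) (at x)" if "x \<in> U" for x
    using assms that by (simp add: Cr_open_2_iff frechet_derivative_works del: One_nat_def)
  show "continuous_on U (\<lambda>x. frechet_derivative g (at x) v)" for v
    using assms Cr_open_1D(3) unfolding Cr_open_2_iff by blast
qed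

lemma Cr_open_1_bounded_linear:
  assumes "Cr_open 1 U g" "bounded_linear l"
  shows "Cr_open 1 U (\<lambda>x. l (g x))"
  by (rule Cr_open_1I[OF bounded_linear.has_derivative[OF assms(2) Cr_open_1D(1)[OF assms(1)]]])
    (rule bounded_linear.continuous_on[OF assms(2)] Cr_open_1D(2)[OF assms(1)] | assumption)+

lemma Cr_open_1_compose_linear:
  assumes "Cr_open 1 U g" "bounded_linear l"
  shows "Cr_open 1 (l -` U) (\<lambda>x. g (l x))"
proof (rule Cr_open_1I)
  fix x assume "x \<in> l -` U"
  then show "((\<lambda>x. g (l x)) has_derivative (\<lambda>v. frechet_derivative g (at (l x)) (l v))) (at x)"
    using Cr_open_1D(1)[OF assms(1)] bounded_linear_imp_has_derivative[OF assms(2)]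
    by (auto intro: has_derivative_compose)
next
  fix v
  show "continuous_on (l -` U) (\<lambda>x. frechet_derivative g (at (l x)) (l v))"
    by (rule continuous_on_compose2[OF Cr_open_1D(2)[OF assms(1)]])
      (auto intro: linear_continuous_on assms)
qed

lemma Cr_open_1_sum:
  assumes "\<And>i. i \<in> I \<Longrightarrow> Cr_open 1 U (g i)"
  shows "Cr_open 1 U (\<lambda>x. \<Sum>i\<in>I. g i x)"
  by (rule Cr_open_1I[where g'="\<lambda>x v. \<Sum>i\<in>I. frechet_derivative (g i) (at x) v"])
    (rule has_derivative_sum continuous_on_sum Cr_open_1D(1,2)[OF assms] | assumption)+

lemma Cr_open_1_diff:
  assumes "Cr_open 1 U g" "Cr_open 1 U h"
  shows "Cr_open 1 U (\<lambda>x. g x - h x)"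
  by (rule Cr_open_1I[OF has_derivative_diff])
    (rule continuous_on_diff Cr_open_1D(1,2)[OF assms(1)] Cr_open_1D(1,2)[OF assms(2)] | assumption)+

lemma Cr_open_1_Pair:
  assumes "Cr_open 1 U g" "Cr_open 1 U h"
  shows "Cr_open 1 U (\<lambda>x. (g x, h x))"
  by (rule Cr_open_1I[OF has_derivative_Pair])
    (rule continuous_on_Pair Cr_open_1D(1,2)[OF assms(1)] Cr_open_1D(1,2)[OF assms(2)] | assumption)+

lemma Cr_open_1_bilinear:
  assumes "bounded_bilinear pr" "Cr_open 1 U g" "Cr_open 1 U h"
  shows "Cr_open 1 U (\<lambda>x. pr (g x) (h x))"
  by (rule Cr_open_1I[OF bounded_bilinear.FDERIV[OF assms(1)]])
    (rule continuous_on_add bounded_bilinear.continuous_on[OF assms(1)]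
      Cr_open_1D[OF assms(2)] Cr_open_1D[OF assms(3)] | assumption)+

lemma Cr_open_1_linear: "bounded_linear l \<Longrightarrow> Cr_open 1 U l"
  by (rule Cr_open_1I[OF bounded_linear_imp_has_derivative]) auto

section \<open>Linearity of the additive compound and regularity of
  \<open>Df_compound\<close>\<close>

text \<open>By the Leibniz formula a minor is a polynomial in the entries.\<close>

lemma matrix_minor_differentiable: "(\<lambda>A. matrix_minor A I J) differentiable (at A)"
proof (cases "length I = length J")
  case True
  define n where "n = length I"
  have eq: "matrix_minor A I J = (\<Sum>p | p permutes {0..<n}. signof p * (\<Prod>i = 0..<n. A $ (I ! i) $ (J ! p i)))" for A
  proof -
    have "p i < n" if "p permutes {0..<n}" "i < n" for p i
      using permutes_in_image[OF that(1), of i] that(2) by simp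
    then show ?thesis
      unfolding matrix_minor_def True[symmetric] n_def[symmetric]
      by (subst det_def'[of _ n]) (auto intro!: sum.cong arg_cong[of _ _ "(*) _"] prod.cong)
  qed
  have entry: "(\<lambda>A. A $ i $ j) differentiable (at A)" for i j and A :: "real^'n^'n"
    using bounded_linear_compose[OF bounded_linear_vec_nth bounded_linear_vec_nth]
    by (rule bounded_linear_imp_differentiable)
  have "(\<lambda>A. \<Prod>i = 0..<l. A $ (I ! i) $ (J ! p i)) differentiable (at A)" for l :: nat and p
    by (induction l) (simp_all add: entry)
  then have "(\<lambda>A. \<Sum>p | p permutes {0..<n}. signof p * (\<Prod>i = 0..<n. A $ (I ! i) $ (J ! p i))) differentiable (at A)"
    by (intro differentiable_sum ballI finite_permutations finite_atLeastLessThan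
        differentiable_mult[OF differentiable_const])
  then show ?thesis unfolding eq[symmetric] .
next
  case False
  \<comment> \<open>\<open>Determinant.det\<close> of a nonsquare matrix is 0 by convention.\<close>
  have "matrix_minor A I J = 0" for A
    unfolding matrix_minor_def
    by (subst Determinant.det_def, subst if_not_P) (use False in \<open>simp_all only: dim_row_mat dim_col_mat not_False_eq_True\<close>)
  then have "(\<lambda>A. matrix_minor A I J) = (\<lambda>A. 0)" by (rule ext)
  then show ?thesis by (metis differentiable_const)
qed

lemma mult_compound_differentiable:
  "(mult_compound k :: _ \<Rightarrow> real^'m::{finite,linorder}^'m::{finite,linorder}) differentiable (at A)"
proof (rule differentiable_componentwise_within[THEN iffD2], rule ballI)
  fix b :: "real^'m::{finite,linorder}^'m::{finite,linorder}"
  assume "b \<in> Basis"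
  then obtain i j where b: "b = axis i (axis j 1)" by (auto simp: Basis_vec_def)
  have "(\<lambda>A. mult_compound k A \<bullet> b) = (\<lambda>A. matrix_minor A (inc_tuple k i) (inc_tuple k j))"
    by (rule ext) (simp add: b inner_axis mult_compound_def)
  then show "(\<lambda>A. mult_compound k A \<bullet> b) differentiable (at A)"
    by (rule ssubst[where P="\<lambda>g. g differentiable _"]) (rule matrix_minor_differentiable)
qed

text \<open>The derivative along the line \<open>?I + \<delta> *\<^sub>R A\<close> is the Frechet
  derivative of \<open>mult_compound k\<close> at the identity applied to \<open>A\<close>, hence
  linear in \<open>A\<close>.\<close>

lemma add_compound_bounded_linear:
  "bounded_linear (add_compound k :: real^'n::{finite,linorder}^'n::{finite,linorder} \<Rightarrow> real^'m::{finite,linorder}^'m::{finite,linorder})"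
proof -
  let ?I = "Finite_Cartesian_Product.mat 1 :: real^'n::{finite,linorder}^'n::{finite,linorder}"
  obtain L where L: "((mult_compound k :: _ \<Rightarrow> real^'m::{finite,linorder}^'m::{finite,linorder}) has_derivative L) (at ?I)"
    using mult_compound_differentiable unfolding differentiable_def by blast
  interpret bounded_linear L using L by (rule has_derivative_bounded_linear)
  have "add_compound k A = L A" for A
    unfolding add_compound_def
  proof (rule vector_derivative_at)
    have "((\<lambda>\<delta>. ?I + \<delta> *\<^sub>R A) has_derivative (\<lambda>\<delta>. \<delta> *\<^sub>R A)) (at 0)"
      by (auto intro!: derivative_eq_intros)
    from has_derivative_compose[OF this, of "mult_compound k" L] L
    show "((\<lambda>\<delta>. mult_compound k (?I + \<delta> *\<^sub>R A) :: real^'m::{finite,linorder}^'m::{finite,linorder}) has_vector_derivative L A) (at 0)"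
      by (simp add: has_vector_derivative_def scaleR)
  qed
  then have "add_compound k = L" by (rule ext)
  then show ?thesis using bounded_linear_axioms by simp
qed

text \<open>Expresses the compound of the Jacobian by fixed linear maps of the directional
  derivatives of \<open>f\<close>, the objects whose regularity \<open>Cr_open\<close> describes.
  \<open>Q j\<close> places a vector in column \<open>j\<close>.\<close>

lemma Df_compound_linear:
  fixes f :: "real^'n::{finite,linorder} \<Rightarrow> real^'n::{finite,linorder}"
  obtains R :: "'n::{finite,linorder} \<Rightarrow> real^'n::{finite,linorder} \<Rightarrow> real^'m::{finite,linorder}^'m::{finite,linorder}"
  where "\<And>j. bounded_linear (R j)"
    "Df_compound f k = (\<lambda>x. \<Sum>j\<in>UNIV. R j (frechet_derivative f (at x) (axis j 1)))"
proof -
  define Q :: "'n::{finite,linorder} \<Rightarrow> real^'n::{finite,linorder} \<Rightarrow> real^'n::{finite,linorder}^'n::{finite,linorder}" where "Q j v = (\<chi> i j'. if j' = j then v $ i else 0)" for j v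
  have Q: "bounded_linear (Q j)" for j
    unfolding linear_conv_bounded_linear[symmetric]
    by (rule linearI) (auto simp: Q_def Finite_Cartesian_Product.vec_eq_iff)
  have J: "jacobian f (at x) = (\<Sum>j\<in>UNIV. Q j (frechet_derivative f (at x) (axis j 1)))" for x
    by (simp add: jacobian_def matrix_def Q_def Finite_Cartesian_Product.vec_eq_iff)
  interpret C: bounded_linear "add_compound k :: _ \<Rightarrow> real^'m::{finite,linorder}^'m::{finite,linorder}" by (rule add_compound_bounded_linear)
  show thesis
  proof (rule that[of "\<lambda>j v. add_compound k (Q j v)"])
    show "bounded_linear (\<lambda>v. add_compound k (Q j v) :: real^'m::{finite,linorder}^'m::{finite,linorder})" for j
      by (rule bounded_linear_compose[OF C.bounded_linear_axioms Q])
  qed (simp add: fun_eq_iff Df_compound_def J C.sum)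
qed

lemma Df_compound_continuous_on:
  fixes f :: "real^'n::{finite,linorder} \<Rightarrow> real^'n::{finite,linorder}"
  assumes "Cr_open 1 U f"
  shows "continuous_on U (Df_compound f k :: _ \<Rightarrow> real^'m::{finite,linorder}^'m::{finite,linorder})"
proof -
  obtain R :: "'n \<Rightarrow> real^'n::{finite,linorder} \<Rightarrow> real^'m::{finite,linorder}^'m::{finite,linorder}" where R: "\<And>j. bounded_linear (R j)"
    "Df_compound f k = (\<lambda>x. \<Sum>j\<in>UNIV. R j (frechet_derivative f (at x) (axis j 1)))"
    by (rule Df_compound_linear) (rule that)
  show ?thesis
    unfolding R(2)
    by (rule continuous_on_sum bounded_linear.continuous_on[OF R(1)] Cr_open_1D(2)[OF assms])+
qed

lemma Df_compound_Cr_open_1: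
  fixes f :: "real^'n::{finite,linorder} \<Rightarrow> real^'n::{finite,linorder}"
  assumes "Cr_open 2 U f"
  shows "Cr_open 1 U (Df_compound f k :: _ \<Rightarrow> real^'m::{finite,linorder}^'m::{finite,linorder})"
proof -
  obtain R :: "'n \<Rightarrow> real^'n::{finite,linorder} \<Rightarrow> real^'m::{finite,linorder}^'m::{finite,linorder}" where R: "\<And>j. bounded_linear (R j)"
    "Df_compound f k = (\<lambda>x. \<Sum>j\<in>UNIV. R j (frechet_derivative f (at x) (axis j 1)))"
    by (rule Df_compound_linear) (rule that)
  have "Cr_open 1 U (\<lambda>x. frechet_derivative f (at x) v)" for v
    using assms unfolding Cr_open_2_iff by blast
  then show ?thesis
    unfolding R(2) by (rule Cr_open_1_sum[OF Cr_open_1_bounded_linear[OF _ R(1)]])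
qed

lemma bounded_bilinear_matrix_vector_mult:
  "bounded_bilinear ((*v) :: real^'n^'m \<Rightarrow> real^'n \<Rightarrow> real^'m)"
proof -
  have "bilinear ((*v) :: real^'n^'m \<Rightarrow> real^'n \<Rightarrow> real^'m)"
    unfolding bilinear_def
    by (intro conjI allI linearI)
      (simp_all only: matrix_vector_right_distrib matrix_vector_mult_add_rdistrib
        scaleR_matrix_vector_assoc matrix_vector_mult_scaleR)
  then show ?thesis by (simp add: bilinear_conv_bounded_bilinear)
qed

text \<open>In finite dimension, continuity of every directional derivative implies continuity in
  operator norm.\<close>

lemma Cr_open_1_imp_C1_deriv:
  assumes "Cr_open 1 U g"
  shows "C1_deriv U g (\<lambda>x. Blinfun (frechet_derivative g (at x)))"
proof -
  have bl: "blinfun_apply (Blinfun (frechet_derivative g (at x))) = frechet_derivative g (at x)" if "x \<in> U" for x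
    using has_derivative_bounded_linear[OF Cr_open_1D(1)[OF assms that]] by (rule bounded_linear_Blinfun_apply)
  have "continuous_on U (\<lambda>x. blinfun_apply (Blinfun (frechet_derivative g (at x))) i)" for i
    by (rule continuous_on_eq[OF Cr_open_1D(2)[OF assms]]) (simp add: bl)
  then have "continuous_on U (\<lambda>x. Blinfun (frechet_derivative g (at x)))"
    by (rule continuous_on_blinfun_componentwise)
  then show ?thesis
    using Cr_open_1D(1)[OF assms] by (simp add: C1_deriv_def bl)
qed

lemma C1_deriv_imp_Cr_open_1:
  assumes "C1_deriv U g g'"
  shows "Cr_open 1 U g"
proof (rule Cr_open_1I)
  show "(g has_derivative g' x) (at x)" if "x \<in> U" for x
    using assms that by (simp add: C1_deriv_def)
  have "continuous_on U g'" using assms by (simp add: C1_deriv_def)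
  then show "continuous_on U (\<lambda>x. g' x v)" for v by (intro continuous_intros)
qed

section \<open>Projective dynamics and the Lyapunov exponent sum\<close>

text \<open>Linearity gives \<open>L (y t) = \<nu> *\<^sub>R L (z t)\<close>, so the logarithmic
  growth rate and the motion of the direction depend on \<open>z\<close> alone. The subtracted
  multiple of \<open>z\<close> comes from differentiating \<open>1 / norm (y t)\<close>.\<close>

lemma projective_flow:
  fixes y :: "real \<Rightarrow> 'a::real_inner"
  assumes y: "(y has_vector_derivative L (y t)) (at t within S)" and L: "linear L" and nz: "y t \<noteq> 0"
  defines "z \<equiv> \<lambda>t. y t /\<^sub>R norm (y t)"
  shows "((\<lambda>t. ln (norm (y t))) has_vector_derivative (z t \<bullet> L (z t))) (at t within S)"
    and "(z has_vector_derivative (L (z t) - (z t \<bullet> L (z t)) *\<^sub>R z t)) (at t within S)"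
proof -
  define \<nu> where "\<nu> = norm (y t)"
  have \<nu>: "\<nu> > 0" using nz by (simp add: \<nu>_def)
  have yt: "y t = \<nu> *\<^sub>R z t" using nz by (simp add: z_def \<nu>_def)
  have Ly: "L (y t) = \<nu> *\<^sub>R L (z t)" unfolding yt using L by (simp add: linear_scale)
  have "((\<lambda>t. norm (y t)) has_derivative (\<lambda>h. (h *\<^sub>R L (y t)) \<bullet> sgn (y t))) (at t within S)"
    using y has_derivative_norm[OF nz] unfolding has_vector_derivative_def by (rule has_derivative_compose)
  then have n: "((\<lambda>t. norm (y t)) has_real_derivative \<nu> * (z t \<bullet> L (z t))) (at t within S)"
    unfolding Ly has_field_derivative_def
    by (simp add: sgn_div_norm z_def inner_commute mult_ac mult_commute_abs)
  have "((\<lambda>t. ln (norm (y t))) has_real_derivative (1 / norm (y t)) * (\<nu> * (z t \<bullet> L (z t)))) (at t within S)"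
    using nz by (auto intro!: derivative_eq_intros n)
  then show "((\<lambda>t. ln (norm (y t))) has_vector_derivative (z t \<bullet> L (z t))) (at t within S)"
    using \<nu> by (simp add: \<nu>_def[symmetric] has_real_derivative_iff_has_vector_derivative)
  have "((\<lambda>t. inverse (norm (y t))) has_real_derivative (- (\<nu> * (z t \<bullet> L (z t)) / (norm (y t) * norm (y t))))) (at t within S)"
    using nz by (auto intro!: derivative_eq_intros n simp: field_simps power2_eq_square)
  then have "((\<lambda>t. inverse (norm (y t))) has_real_derivative (- ((z t \<bullet> L (z t)) / \<nu>))) (at t within S)"
    using \<nu> by (simp add: \<nu>_def[symmetric])
  from has_vector_derivative_scaleR[OF this y]
  have "(z has_vector_derivative (inverse \<nu> *\<^sub>R L (y t) + (- ((z t \<bullet> L (z t)) / \<nu>)) *\<^sub>R y t)) (at t within S)"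
    unfolding z_def \<nu>_def .
  then show "(z has_vector_derivative (L (z t) - (z t \<bullet> L (z t)) *\<^sub>R z t)) (at t within S)"
    unfolding Ly unfolding yt using \<nu> by simp
qed

lemma trajectory_continuous_on: "ivp_solution F u0 u \<Longrightarrow> continuous_on {0..} u"
  unfolding ivp_solution_def continuous_on_eq_continuous_within
  using has_vector_derivative_continuous by force

lemma projective_trajectory:
  fixes f :: "real^'n::{finite,linorder} \<Rightarrow> real^'n::{finite,linorder}"
    and y :: "real \<Rightarrow> real^'m::{finite,linorder}"
  assumes f: "Cr_open 1 U f" and xU: "\<forall>t\<ge>0. x t \<in> U"
    and x: "trajectory f x0 x"
    and y: "ivp_solution (\<lambda>t v. Df_compound f k (x t) *v v) y0 y" and y0: "norm y0 = 1" and t: "t \<ge> 0"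
  shows "norm (y t /\<^sub>R norm (y t)) = 1"
    and "((\<lambda>t. ln (norm (y t))) has_vector_derivative Phi f k (x t) (y t /\<^sub>R norm (y t))) (at t within {0..})"
    and "((\<lambda>t. (x t, y t /\<^sub>R norm (y t))) has_vector_derivative
           (f (x t), ell f k (x t) (y t /\<^sub>R norm (y t)))) (at t within {0..})"
proof -
  have yd: "(y has_vector_derivative Df_compound f k (x t) *v y t) (at t within {0..})" if "t \<ge> 0" for t
    using y that by (simp add: ivp_solution_def)
  have cA: "continuous_on {0..} (\<lambda>t. Df_compound f k (x t) :: real^'m::{finite,linorder}^'m::{finite,linorder})"
    by (rule continuous_on_compose2[OF Df_compound_continuous_on[OF f] trajectory_continuous_on[OF x]])
      (use xU in auto)
  have y0': "y 0 \<noteq> 0" using y y0 by (auto simp: ivp_solution_def)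
  have nz: "y t \<noteq> 0"
    by (rule linear_ode_nonzero[OF bounded_bilinear_matrix_vector_mult cA yd y0' t])
  then show "norm (y t /\<^sub>R norm (y t)) = 1" by simp
  have lin: "linear ((*v) (Df_compound f k (x t) :: real^'m::{finite,linorder}^'m::{finite,linorder}))"
    by simp
  show "((\<lambda>t. ln (norm (y t))) has_vector_derivative Phi f k (x t) (y t /\<^sub>R norm (y t))) (at t within {0..})"
    unfolding Phi_def by (rule projective_flow(1)[OF yd[OF t] lin nz])
  have "((\<lambda>t. y t /\<^sub>R norm (y t)) has_vector_derivative ell f k (x t) (y t /\<^sub>R norm (y t))) (at t within {0..})"
    unfolding ell_def Phi_def by (rule projective_flow(2)[OF yd[OF t] lin nz])
  moreover have "(x has_vector_derivative f (x t)) (at t within {0..})"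
    using x t by (simp add: ivp_solution_def)
  ultimately show "((\<lambda>t. (x t, y t /\<^sub>R norm (y t))) has_vector_derivative
           (f (x t), ell f k (x t) (y t /\<^sub>R norm (y t)))) (at t within {0..})"
    by (rule has_vector_derivative_Pair[rotated])
qed

section \<open>The upper bound\<close>

text \<open>\<open>B\<close> and \<open>K\<close> have separate tasks: the trajectory stays in
  \<open>B\<close>, where \<open>aux_sup\<close> bounds the derivative of
  \<open>ln (norm (y t)) + V\<close>, while the compact \<open>K\<close> bounds \<open>V\<close>.
  This permits a \<open>K\<close> that reaches outside \<open>B\<close>.\<close>

lemma growth_bound:
  fixes f :: "real^'n::{finite,linorder} \<Rightarrow> real^'n::{finite,linorder}"
    and y :: "real \<Rightarrow> real^'m::{finite,linorder}"
    and V :: "(real^'n::{finite,linorder}) \<times> (real^'m::{finite,linorder}) \<Rightarrow> real"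
  assumes f: "Cr_open 1 U f" "B \<subseteq> U" and xB: "\<And>t. t \<ge> 0 \<Longrightarrow> x t \<in> B"
    and x: "trajectory f x0 x"
    and y: "ivp_solution (\<lambda>t v. Df_compound f k (x t) *v v) y0 y" and y0: "norm y0 = 1"
    and V: "Cr_open 1 W V" "K \<times> UNIV \<subseteq> W" "compact K" "x ` {0..} \<subseteq> K"
    and S: "aux_sup f k B V \<le> ereal s"
  shows "Limsup at_top (\<lambda>t. ereal (1 / t * ln (norm (y t)))) \<le> ereal s"
proof -
  define z where "z t = y t /\<^sub>R norm (y t)" for t
  have xU: "\<forall>t\<ge>0. x t \<in> U" using xB f by auto
  note pt = projective_trajectory[OF f(1) xU x y y0, folded z_def]
  let ?V' = "\<lambda>p. frechet_derivative V (at p)"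
  have V': "(V has_derivative ?V' p) (at p)" if "p \<in> W" for p
    using Cr_open_1D(1)[OF V(1) that] .
  have inW: "(x t, z) \<in> W" if "t \<ge> 0" for t z using that V(2,4) by auto
  have "compact (K \<times> sphere (0::real^'m::{finite,linorder}) 1)" using V by (intro compact_Times) auto
  then have "compact (V ` (K \<times> sphere 0 1))"
    using Cr_open_1D(3)[OF V(1)] V(2) by (intro compact_continuous_image) (auto intro: continuous_on_subset)
  from compact_imp_bounded[OF this] obtain b where b: "\<And>p. p \<in> K \<times> sphere 0 1 \<Longrightarrow> \<bar>V p\<bar> \<le> b"
    unfolding bounded_iff by auto
  have bV: "\<bar>V (x t, z t)\<bar> \<le> b" if "t \<ge> 0" for t
    using that V(4) pt(1) by (intro b) auto
  have J: "ln (norm (y t)) + V (x t, z t) \<le> (ln (norm (y 0)) + V (x 0, z 0)) + s * t" if "t \<ge> 0" for t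
  proof (rule derivative_le_imp_le_linear[where \<phi>'="\<lambda>t. Phi f k (x t) (z t) + ?V' (x t, z t) (f (x t), ell f k (x t) (z t))"])
    fix t :: real assume t: "t \<ge> 0"
    have "((\<lambda>t. V (x t, z t)) has_vector_derivative ?V' (x t, z t) (f (x t), ell f k (x t) (z t))) (at t within {0..})"
    proof -
      have "linear (?V' (x t, z t))" using V'[OF inW[OF t]] by (rule has_derivative_linear)
      then show ?thesis
        using has_derivative_compose[OF pt(3)[OF t, unfolded has_vector_derivative_def] V'[OF inW[OF t]]]
        by (simp only: has_vector_derivative_def linear_scale)
    qed
    with pt(2)[OF t]
    show "((\<lambda>t. ln (norm (y t)) + V (x t, z t)) has_vector_derivative
            Phi f k (x t) (z t) + ?V' (x t, z t) (f (x t), ell f k (x t) (z t))) (at t within {0..})"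
      by (rule has_vector_derivative_add)
    have "ereal (Phi f k (x t) (z t) + f (x t) \<bullet> gradient (\<lambda>x'. V (x', z t)) (x t)
               + ell f k (x t) (z t) \<bullet> gradient (\<lambda>z'. V (x t, z')) (z t)) \<le> aux_sup f k B V"
      unfolding aux_sup_def
      by (rule SUP_upper2[of "(x t, z t)"]) (use xB[OF t] pt(1)[OF t] in auto)
    also have "\<dots> \<le> ereal s" by (rule S)
    finally show "Phi f k (x t) (z t) + ?V' (x t, z t) (f (x t), ell f k (x t) (z t)) \<le> s"
      unfolding partial_gradients_inner[OF V'[OF inW[OF t]], symmetric] by (simp add: add.assoc)
  qed (use that in auto)
  have "ln (norm (y 0)) = 0" using y y0 by (simp add: ivp_solution_def)
  then have le: "ln (norm (y t)) \<le> s * t + 2 * b" if "t \<ge> 0" for t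
    using J[OF that] bV[OF that] bV[of 0] by simp
  show ?thesis
  proof (rule ereal_le_epsilon2)
    fix e :: real assume e: "e > 0"
    \<comment> \<open>Beyond this time the contribution \<open>2 * b\<close> of \<open>V\<close> is
      at most \<open>e * t\<close>.\<close>
    have "eventually (\<lambda>t. t > max 0 (2 * b / e)) at_top" by (rule eventually_gt_at_top)
    then have "eventually (\<lambda>t. ereal (1 / t * ln (norm (y t))) \<le> ereal (s + e)) at_top"
    proof eventually_elim
      case (elim t)
      then have t: "t > 0" "2 * b \<le> e * t" using e by (auto simp: field_simps)
      then have "ln (norm (y t)) \<le> (s + e) * t" using le[of t] by (simp add: algebra_simps)
      then show ?case using t by (simp add: field_simps)
    qed
    then show "Limsup at_top (\<lambda>t. ereal (1 / t * ln (norm (y t)))) \<le> ereal s + ereal e"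
      by (simp add: Limsup_bounded)
  qed
qed

lemma lyapunov_sum_le_aux_sup:
  fixes f :: "real^'n::{finite,linorder} \<Rightarrow> real^'n::{finite,linorder}"
    and V :: "(real^'n::{finite,linorder}) \<times> (real^'m::{finite,linorder}) \<Rightarrow> real"
  assumes f: "Cr_on 1 B f" and inv: "forward_invariant f B" and x0: "x0 \<in> B"
    and K: "\<And>x. trajectory f x0 x \<Longrightarrow> \<exists>K. compact K \<and> K \<subseteq> C \<and> x ` {0..} \<subseteq> K"
    and V: "Cr_on 1 (C \<times> UNIV) V"
  shows "lyapunov_sum TYPE('m) f k x0 \<le> aux_sup f k B V"
  unfolding lyapunov_sum_def
proof (rule Sup_least, clarify)
  fix x and y :: "real \<Rightarrow> real^'m::{finite,linorder}" and y0 :: "real^'m::{finite,linorder}"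
  assume y0: "y0 \<in> sphere 0 1" and x: "trajectory f x0 x"
    and y: "ivp_solution (\<lambda>t v. Df_compound f k (x t) *v v) y0 y"
  obtain U where U: "B \<subseteq> U" "Cr_open 1 U f" using f unfolding Cr_on_def by blast
  obtain W where W: "C \<times> UNIV \<subseteq> W" "Cr_open 1 W V" using V unfolding Cr_on_def by blast
  obtain K where K: "compact K" "K \<subseteq> C" "x ` {0..} \<subseteq> K" using K[OF x] by blast
  have xB: "\<And>t. t \<ge> 0 \<Longrightarrow> x t \<in> B" using inv x0 x unfolding forward_invariant_def by blast
  show "Limsup at_top (\<lambda>t. ereal (1 / t * ln (norm (y t)))) \<le> aux_sup f k B V"
  \<comment> \<open>Comparison with all real upper bounds \<open>s\<close> covers infinite values of
    \<open>aux_sup\<close> as well.\<close>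
  proof (rule ereal_le_real)
    fix s assume "aux_sup f k B V \<le> ereal s"
    then show "Limsup at_top (\<lambda>t. ereal (1 / t * ln (norm (y t)))) \<le> ereal s"
      using y0 K W by (intro growth_bound[OF U(2,1) xB x y _ W(2) _ K(1,3)]) auto
  qed
qed

section \<open>The converse inequality on a compact set\<close>

text \<open>The first component ignores \<open>z\<close>, so membership of the iterates in a
  cylinder over \<open>x\<close> can be tested at any \<open>z\<close>.\<close>

lemma fst_euler_skew_product: "fst (euler h (\<lambda>(x, z). (f x, g x z)) j (x, z)) = euler h f j x"
  by (induction j) (auto simp: case_prod_beta)

text \<open>Applies the general construction to the flow of \<open>(f, ell)\<close> on
  \<open>B \<times> sphere 0 1\<close>. Second-order smoothness of \<open>f\<close> enters because
  \<open>F\<close> and \<open>\<Phi>\<close> contain its Jacobian and must be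
  \<open>C1_deriv\<close>.\<close>

lemma auxiliary_function_near_lyapunov_sum:
  fixes f :: "real^'n::{finite,linorder} \<Rightarrow> real^'n::{finite,linorder}"
  assumes B: "compact B" and f: "Cr_on 2 B f" and inv: "forward_invariant f B"
    and \<mu>: "\<And>x0. x0 \<in> B \<Longrightarrow> lyapunov_sum TYPE('m::{finite,linorder}) f k x0 < ereal \<mu>" and \<epsilon>: "\<epsilon> > 0"
  shows "\<exists>V :: (real^'n::{finite,linorder}) \<times> (real^'m::{finite,linorder}) \<Rightarrow> real.
    Cr_on 1 (B \<times> UNIV) V \<and> aux_sup f k B V \<le> ereal (\<mu> + \<epsilon>)"
proof -
  obtain U where U: "open U" "B \<subseteq> U" and f2: "Cr_open 2 U f" using f unfolding Cr_on_def by blast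
  have f1: "Cr_open 1 U f" by (rule Cr_open_2_imp_1[OF f2])
  define \<Omega> :: "((real^'n::{finite,linorder}) \<times> (real^'m::{finite,linorder})) set" where "\<Omega> = fst -` U"
  define F :: "(real^'n::{finite,linorder}) \<times> (real^'m::{finite,linorder}) \<Rightarrow> _"
    where "F = (\<lambda>(x, z). (f x, ell f k x z))"
  define \<Phi> :: "(real^'n::{finite,linorder}) \<times> (real^'m::{finite,linorder}) \<Rightarrow> _"
    where "\<Phi> = (\<lambda>(x, z). Phi f k x z)"
  define K :: "((real^'n::{finite,linorder}) \<times> (real^'m::{finite,linorder})) set" where "K = B \<times> sphere 0 1"
  have \<Omega>: "open \<Omega>" unfolding \<Omega>_def using U by (intro open_vimage continuous_on_fst continuous_on_id)
  have K: "compact K" "K \<subseteq> \<Omega>" using B U by (auto simp: K_def \<Omega>_def intro!: compact_Times)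
  let ?A = "\<lambda>p. Df_compound f k (fst p) :: real^'m::{finite,linorder}^'m::{finite,linorder}"
  have A: "Cr_open 1 \<Omega> ?A"
    unfolding \<Omega>_def by (rule Cr_open_1_compose_linear[OF Df_compound_Cr_open_1[OF f2] bounded_linear_fst])
  have fx: "Cr_open 1 \<Omega> (\<lambda>p. f (fst p))"
    unfolding \<Omega>_def by (rule Cr_open_1_compose_linear[OF f1 bounded_linear_fst])
  have snd: "Cr_open 1 \<Omega> snd" by (rule Cr_open_1_linear[OF bounded_linear_snd])
  have Az: "Cr_open 1 \<Omega> (\<lambda>p. ?A p *v snd p)"
    by (rule Cr_open_1_bilinear[OF bounded_bilinear_matrix_vector_mult A snd])
  have \<Phi>1: "Cr_open 1 \<Omega> (\<lambda>p. snd p \<bullet> (?A p *v snd p))"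
    by (rule Cr_open_1_bilinear[OF bounded_bilinear_inner snd Az])
  moreover have "\<Phi> = (\<lambda>p. snd p \<bullet> (?A p *v snd p))" by (auto simp: \<Phi>_def Phi_def)
  ultimately have "Cr_open 1 \<Omega> \<Phi>" by simp
  from Cr_open_1_imp_C1_deriv[OF this] obtain \<Phi>' where \<Phi>': "C1_deriv \<Omega> \<Phi> \<Phi>'" ..
  have "Cr_open 1 \<Omega> (\<lambda>p. (f (fst p), ?A p *v snd p - (snd p \<bullet> (?A p *v snd p)) *\<^sub>R snd p))"
    by (rule Cr_open_1_Pair[OF fx
          Cr_open_1_diff[OF Az Cr_open_1_bilinear[OF bounded_bilinear_scaleR \<Phi>1 snd]]])
  moreover have "F = (\<lambda>p. (f (fst p), ?A p *v snd p - (snd p \<bullet> (?A p *v snd p)) *\<^sub>R snd p))"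
    by (auto simp: F_def ell_def Phi_def)
  ultimately have "Cr_open 1 \<Omega> F" by simp
  from Cr_open_1_imp_C1_deriv[OF this] obtain F' where F': "C1_deriv \<Omega> F F'" ..
  have orbit: "\<exists>X I t. orbit_in K F \<Phi> X I \<and> X 0 = p \<and> t > 0 \<and> I t < \<mu> * t" if pK: "p \<in> K" for p
  proof -
    obtain x0 y0 where p: "p = (x0, y0)" "x0 \<in> B" "y0 \<in> sphere 0 1" using pK by (auto simp: K_def)
    obtain x where x: "trajectory f x0 x" and xB: "\<And>t. t \<ge> 0 \<Longrightarrow> x t \<in> B"
      using inv p unfolding forward_invariant_def by blast
    let ?D = "\<lambda>t. Df_compound f k (x t) :: real^'m::{finite,linorder}^'m::{finite,linorder}"
    have cD: "continuous_on B (Df_compound f k :: _ \<Rightarrow> real^'m::{finite,linorder}^'m::{finite,linorder})"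
      by (rule continuous_on_subset[OF Df_compound_continuous_on[OF f1] U(2)])
    have "continuous_on {0..} ?D"
      by (rule continuous_on_compose2[OF cD trajectory_continuous_on[OF x]]) (use xB in auto)
    moreover have "bounded (?D ` {0..})"
      by (rule bounded_subset[OF compact_imp_bounded[OF compact_continuous_image[OF cD B]]]) (use xB in auto)
    ultimately obtain y where "y 0 = y0"
      "\<And>t. t \<ge> 0 \<Longrightarrow> (y has_vector_derivative ?D t *v y t) (at t within {0..})"
      using linear_ode_solution_exists[OF bounded_bilinear_matrix_vector_mult] by blast
    then have y: "ivp_solution (\<lambda>t v. ?D t *v v) y0 y" by (simp add: ivp_solution_def)
    have xU: "\<forall>t\<ge>0. x t \<in> U" using xB U by auto
    have n1: "norm y0 = 1" using p by simp
    note pt = projective_trajectory[OF f1 xU x y n1]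
    have "orbit_in K F \<Phi> (\<lambda>t. (x t, y t /\<^sub>R norm (y t))) (\<lambda>t. ln (norm (y t)))"
      using pt xB y n1 by (auto simp: orbit_in_def K_def F_def \<Phi>_def ivp_solution_def)
    moreover have "(x 0, y 0 /\<^sub>R norm (y 0)) = p" using x y n1 p by (simp add: ivp_solution_def)
    \<comment> \<open>A limsup strictly below \<open>\<mu>\<close> forces the inequality at all
      large times; a single one suffices for the compactness argument.\<close>
    moreover have "\<exists>t>0. ln (norm (y t)) < \<mu> * t"
    proof -
      have "Limsup at_top (\<lambda>t. ereal (1 / t * ln (norm (y t)))) \<le> lyapunov_sum TYPE('m) f k x0"
        unfolding lyapunov_sum_def using p x y by (intro Sup_upper) blast
      also have "\<dots> < ereal \<mu>" by (rule \<mu>[OF p(2)])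
      finally have "eventually (\<lambda>t. ereal (1 / t * ln (norm (y t))) < ereal \<mu>) at_top"
        by (rule Limsup_lessD)
      then have "eventually (\<lambda>t. ereal (1 / t * ln (norm (y t))) < ereal \<mu> \<and> t > 0) at_top"
        using eventually_gt_at_top by (rule eventually_conj)
      then obtain t where "1 / t * ln (norm (y t)) < \<mu>" "t > 0"
        using eventually_happens by fastforce
      then show ?thesis by (auto simp: field_simps intro!: exI[of _ t])
    qed
    ultimately show ?thesis by blast
  qed
  obtain h N V V' where V: "C1_deriv (euler_dom h F \<Omega> N) V V'" "K \<subseteq> euler_dom h F \<Omega> N"
    "\<And>p. p \<in> K \<Longrightarrow> \<Phi> p + blinfun_apply (V' p) (F p) \<le> \<mu> + \<epsilon>"
    by (rule auxiliary_function_exists[OF F' \<Phi>' \<Omega> K orbit \<epsilon>]) (assumption | rule that)+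
  \<comment> \<open>The domain is known to contain \<open>(x, w)\<close> for unit vectors
    \<open>w\<close>. As \<open>\<Omega>\<close> is a cylinder over \<open>U\<close>, it then
    contains the whole fibre over \<open>x\<close>.\<close>
  have "B \<times> UNIV \<subseteq> euler_dom h F \<Omega> N"
  proof clarify
    fix x and z :: "real^'m::{finite,linorder}" assume x: "x \<in> B"
    obtain w :: "real^'m::{finite,linorder}" where "norm w = 1" using vector_choose_size[of 1] by auto
    then have "(x, w) \<in> euler_dom h F \<Omega> N" using x V(2) by (auto simp: K_def)
    then show "(x, z) \<in> euler_dom h F \<Omega> N"
      by (simp add: euler_dom_def \<Omega>_def F_def fst_euler_skew_product)
  qed
  then have "Cr_on 1 (B \<times> UNIV) V"
    unfolding Cr_on_def using euler_C1_deriv[OF F' \<Omega>] C1_deriv_imp_Cr_open_1[OF V(1)] by blast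
  moreover have "aux_sup f k B V \<le> ereal (\<mu> + \<epsilon>)"
    unfolding aux_sup_def
  proof (rule SUP_least, clarify)
    fix x and z :: "real^'m::{finite,linorder}" assume "x \<in> B" "z \<in> sphere 0 1"
    then have p: "(x, z) \<in> K" by (simp add: K_def)
    then have "(V has_derivative blinfun_apply (V' (x, z))) (at (x, z))"
      using V(1,2) by (auto simp: C1_deriv_def)
    from partial_gradients_inner[OF this, of "f x" "ell f k x z"] V(3)[OF p]
    show "ereal (Phi f k x z + f x \<bullet> gradient (\<lambda>x'. V (x', z)) x
               + ell f k x z \<bullet> gradient (\<lambda>z'. V (x, z')) z) \<le> ereal (\<mu> + \<epsilon>)"
      by (simp add: F_def \<Phi>_def)
  qed
  ultimately show ?thesis by blast
qed

text \<open>The upper bound has two versions, matching the alternatives described before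
  \<open>aux_sup\<close>: bounded trajectories with \<open>V\<close> regular near the closure, or
  trajectories in compact subsets of \<open>B\<close> with \<open>V\<close> regular near
  \<open>B\<close> only. Both come from \<open>upper\<close>, with \<open>C\<close> equal to
  \<open>closure B\<close> or \<open>B\<close>.\<close>

theorem proposition2p6:
  fixes f :: "real^'n::{finite,linorder} \<Rightarrow> real^'n::{finite,linorder}"
    and B :: "(real^'n::{finite,linorder}) set"
    and k :: nat
  assumes f_C1: "Cr_on 1 B f"
    and inv: "forward_invariant f B"
    and k: "k \<in> {1..CARD('n)}"
    and m: "CARD('m::{finite,linorder}) = CARD('n) choose k"
  shows
    "((\<forall>x0\<in>B. \<forall>x. trajectory f x0 x \<longrightarrow> bounded (x ` {0..})) \<longrightarrow>
        (SUP x0\<in>B. lyapunov_sum TYPE('m) f k x0)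
          \<le> (INF V\<in>{V :: (real^'n::{finite,linorder}) \<times> (real^'m::{finite,linorder}) \<Rightarrow> real.
                  Cr_on 1 (closure B \<times> UNIV) V}. aux_sup f k B V))
     \<and> ((\<forall>x0\<in>B. \<forall>x. trajectory f x0 x \<longrightarrow> (\<exists>K. compact K \<and> K \<subseteq> B \<and> x ` {0..} \<subseteq> K)) \<longrightarrow>
        (SUP x0\<in>B. lyapunov_sum TYPE('m) f k x0)
          \<le> (INF V\<in>{V :: (real^'n::{finite,linorder}) \<times> (real^'m::{finite,linorder}) \<Rightarrow> real.
                  Cr_on 1 (B \<times> UNIV) V}. aux_sup f k B V))
     \<and> (compact B \<and> Cr_on 2 B f \<longrightarrow>
        (SUP x0\<in>B. lyapunov_sum TYPE('m) f k x0)
          = (INF V\<in>{V :: (real^'n::{finite,linorder}) \<times> (real^'m::{finite,linorder}) \<Rightarrow> real.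
                  Cr_on 1 (B \<times> UNIV) V}. aux_sup f k B V))"
proof -
  have upper: "(SUP x0\<in>B. lyapunov_sum TYPE('m) f k x0)
      \<le> (INF V\<in>{V :: (real^'n::{finite,linorder}) \<times> (real^'m::{finite,linorder}) \<Rightarrow> real.
              Cr_on 1 (C \<times> UNIV) V}. aux_sup f k B V)"
    if "\<forall>x0\<in>B. \<forall>x. trajectory f x0 x \<longrightarrow> (\<exists>K. compact K \<and> K \<subseteq> C \<and> x ` {0..} \<subseteq> K)" for C
    using that by (intro SUP_least INF_greatest lyapunov_sum_le_aux_sup[OF f_C1 inv]) blast+
  have xB: "x ` {0..} \<subseteq> B" if "x0 \<in> B" "trajectory f x0 x" for x0 x
    using inv that unfolding forward_invariant_def by auto
  have "\<exists>K. compact K \<and> K \<subseteq> closure B \<and> x ` {0..} \<subseteq> K"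
    if "x0 \<in> B" "trajectory f x0 x" "bounded (x ` {0..})" for x0 x
    using that xB[OF that(1,2)]
    by (intro exI[of _ "closure (x ` {0..})"]) (simp add: closure_subset closure_mono compact_closure)
  then have 1: "(\<forall>x0\<in>B. \<forall>x. trajectory f x0 x \<longrightarrow> bounded (x ` {0..})) \<longrightarrow>
        (SUP x0\<in>B. lyapunov_sum TYPE('m) f k x0)
          \<le> (INF V\<in>{V :: (real^'n::{finite,linorder}) \<times> (real^'m::{finite,linorder}) \<Rightarrow> real.
                  Cr_on 1 (closure B \<times> UNIV) V}. aux_sup f k B V)"
    by (intro impI upper) blast
  have 3: "(SUP x0\<in>B. lyapunov_sum TYPE('m) f k x0)
          = (INF V\<in>{V :: (real^'n::{finite,linorder}) \<times> (real^'m::{finite,linorder}) \<Rightarrow> real.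
                  Cr_on 1 (B \<times> UNIV) V}. aux_sup f k B V)" (is "?M = ?I")
    if B: "compact B" "Cr_on 2 B f"
  proof (rule antisym)
    show "?M \<le> ?I" using B(1) xB by (intro upper) blast
    show "?I \<le> ?M"
    proof (rule dense_ge)
      fix c assume "?M < c"
      \<comment> \<open>Two real numbers are inserted: \<open>\<mu>\<close> lies strictly above
        every exponent sum, and the gap \<open>\<mu>' - \<mu>\<close> is the tolerance of the
        construction.\<close>
      then obtain \<mu>' where \<mu>': "?M < ereal \<mu>'" "ereal \<mu>' < c" using ereal_dense2 by blast
      then obtain \<mu> where \<mu>: "?M < ereal \<mu>" "\<mu> < \<mu>'" using ereal_dense2[OF \<mu>'(1)] by auto
      have "lyapunov_sum TYPE('m) f k x0 < ereal \<mu>" if "x0 \<in> B" for x0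
        using SUP_upper[OF that] \<mu>(1) by (rule le_less_trans)
      from auxiliary_function_near_lyapunov_sum[OF B inv this, of "\<mu>' - \<mu>"] \<mu>(2)
      obtain V :: "(real^'n::{finite,linorder}) \<times> (real^'m::{finite,linorder}) \<Rightarrow> real"
        where "Cr_on 1 (B \<times> UNIV) V" "aux_sup f k B V \<le> ereal \<mu>'" by auto
      then have "?I \<le> ereal \<mu>'" by (intro INF_lower2[of V]) auto
      then show "?I \<le> c" using \<mu>'(2) by simp
    qed
  qed
  from 1 upper[of B] 3 show ?thesis by blast
qed

end
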